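(* Let $\Theta$ be a generic real skew-symmetric $n\times n$ matrix and let $g=\langle\cdot,\cdot\rangle$ be a Riemannian metric on the smooth noncommutative torus $A^\infty_\Theta$ (including condition (4) in the definition of Riemannian metric). Then there is one and only one connection $\nabla$ on $\mathcal{X}_\Theta$ (including conditions (4) and (5) in the definition of connection) that is torsion-free and compatible with the metric. This connection, called the Levi-Civita connection, is determined by the formula $$\langle\nabla_j\partial_k,\partial_\ell\rangle=\frac12\big[\partial_j\langle\partial_k,\partial_\ell\rangle+\partial_k\langle\partial_j,\partial_\ell\rangle-\partial_\ell\langle\partial_j,\partial_k\rangle\big],$$ where $\nabla_j=\nabla_{\partial_j}$.
   Context: Noncommutative torus: for a real skew-symmetric $n\times n$ matrix $\Theta$, $A_\Theta$ is the universal $C^*$-algebra on $n$ unitaries $U_1,\dots,U_n$ with $U_jU_k=e^{2\pi i\Theta_{jk}}U_kU_j$. The torus $\mathbb{T}^n$ acts on it by $t\cdot U_j=t_jU_j$. The infinitesimal generators of this action are the (unbounded) $*$-derivations $\partial_1,\dots,\partial_n$ with $\partial_j(U_k)=2\pi i\,\delta_{jk}U_k$. The smooth noncommutative torus $A^\infty_\Theta$ is the algebra of $C^\infty$ vectors for this action, i.e. the series $\sum c_{m_1,\dots,m_n}U_1^{m_1}\cdots U_n^{m_n}$ with rapidly decreasing coefficients. $\tau$ denotes the canonical trace on $A_\Theta$, which sends such a series to its constant coefficient $c_{0,\dots,0}$. Vector fields: $\mathcal{X}_\Theta$ is the free rank-$n$ left $A^\infty_\Theta$-module with basis $\partial_1,\dots,\partial_n$.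 Derivations: $\mathcal{D}_\Theta$ is the space of $*$-derivations $\delta\colon A^\infty_\Theta\to A^\infty_\Theta$, a Lie algebra under the commutator bracket; write $\delta\cdot a=\delta(a)$. Write $\operatorname{ad}a$ for the inner derivation $b\mapsto[a,b]=ab-ba$. Generic: $\Theta$ is generic if it is "generically transcendental" in the sense of Bratteli, Elliott and Jorgensen, a condition satisfied for almost all $\Theta$. By their theorem, for such $\Theta$ any $\delta\in\mathcal{D}_\Theta$ has a unique decomposition $\delta=a_1\partial_1+\dots+a_n\partial_n+\delta_0$ with $\delta_0$ inner and $a_1,\dots,a_n\in\mathbb{C}$. Riemannian metric: a sesquilinear map $\langle\cdot,\cdot\rangle\colon\mathcal{X}_\Theta\times\mathcal{X}_\Theta\to A^\infty_\Theta$ such that (1) $\langle X+X',Y\rangle=\langle X,Y\rangle+\langle X',Y\rangle$ and $\langle aX,Y\rangle=a\langle X,Y\rangle$ for $X,X',Y\in\mathcal{X}_\Theta$, $a\in A^\infty_\Theta$; (2) $\langle X,Y\rangle^*=\langle Y,X\rangle$; (3) $\langle X,X\rangle\ge0$ in the sense of the $C^*$-algebra $A_\Theta$, with equality only if $X=0$; (4) for each $j,k$, $\langle\partial_j,\partial_k\rangle$ is self-adjoint, and thus $\langle\partial_j,\partial_k\rangle=\langle\partial_k,\partial_j\rangle$. Connection: a map $\nabla\colon\mathcal{D}_\Theta\times\mathcal{X}_\Theta\to\mathcal{X}_\Theta$, written $(X,Y)\mapsto\nabla_XY$, such that (1) $\nabla$ is linear in the first variable: $\nabla_{\lambda X}Y=\lambda\nabla_XY$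 and $\nabla_{X+X'}Y=\nabla_XY+\nabla_{X'}Y$ for $X,X'\in\mathcal{D}_\Theta$, $\lambda\in\mathbb{C}$; (2) $\nabla$ is $\mathbb{C}$-linear in the second variable; (3) $\nabla_X(aY)=(X\cdot a)Y+a\nabla_XY$ for $X\in\mathcal{D}_\Theta$, $Y\in\mathcal{X}_\Theta$, $a\in A^\infty_\Theta$; (4) for any $a\in A^\infty_\Theta$ with $\tau(a)=0$, $\nabla_{\operatorname{ad}a}$ is left multiplication by $a$; (5) (in the presence of a Riemannian metric) for any $j,k,\ell$, $\langle\nabla_j\partial_k,\partial_\ell\rangle$ is self-adjoint. Torsion-free: $\nabla_j\partial_k=\nabla_k\partial_j$ for all $j,k\le n$. Compatible with the metric: $Z\cdot\langle X,Y\rangle=\langle\nabla_ZX,Y\rangle+\langle X,\nabla_ZY\rangle$ for all $X,Y\in\mathcal{X}_\Theta$, $Z\in\mathcal{D}_\Theta$.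
   Formalization: Existence is proved only for metrics whose Gram matrix is invertible over the smooth torus, since it fails e.g. for ⟨X,Y⟩=ΣX_j(2−U_1−U_1* )Y_j*; connection axioms on λX and ad a apply when these are *-derivations; "generic" is a Diophantine condition on Θ. *)

theory Defs
  imports "HOL-Analysis.Analysis"
begin

section \<open>Rapidly decreasing families on the lattice\<close>

definition lsize :: "int ^ 'n::finite \<Rightarrow> real" where
  "lsize m = (\<Sum>j\<in>UNIV. \<bar>real_of_int (m $ j)\<bar>)"

definition rapidly_decreasing :: "(int ^ 'n::finite \<Rightarrow> complex) \<Rightarrow> bool" where
  "rapidly_decreasing c \<longleftrightarrow> (\<forall>k::nat. \<exists>C. \<forall>m. (1 + lsize m) ^ k * cmod (c m) \<le> C)"

lemma lsize_nonneg [simp]: "0 \<le> lsize m"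
  by (simp add: lsize_def sum_nonneg)

lemma lsize_minus [simp]: "lsize (- m) = lsize m"
  by (simp add: lsize_def)

lemma lsize_component: "\<bar>real_of_int (m $ j)\<bar> \<le> lsize m"
  unfolding lsize_def by (rule member_le_sum) auto

lemma lsize_triangle: "lsize p \<le> lsize m + lsize (p - m)"
  unfolding lsize_def sum.distrib [symmetric] by (rule sum_mono) auto

lemma lsize_submult: "1 + lsize p \<le> (1 + lsize m) * (1 + lsize (p - m))"
proof -
  have "(1 + lsize m) * (1 + lsize (p - m)) = 1 + (lsize m + lsize (p - m)) + lsize m * lsize (p - m)"
    by (simp add: algebra_simps)
  moreover have "0 \<le> lsize m * lsize (p - m)" by simp
  ultimately show ?thesis using lsize_triangle [of p m] by linarith
qed

lemma summable_lattice_weight: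
  "(\<lambda>m :: int ^ 'n::finite. inverse ((1 + lsize m) ^ (2 * CARD('n)))) summable_on UNIV"
proof (rule nonneg_bdd_above_summable_on)
  define h where "h i = inverse ((1 + \<bar>real_of_int i\<bar>)\<^sup>2)" for i
  define S where "S = 2 * (\<Sum>k. inverse (real (Suc k) ^ 2))"
  have h0: "0 \<le> h i" for i by (simp add: h_def)
  have sm: "summable (\<lambda>k. inverse (real (Suc k) ^ 2))"
    using inverse_power_summable [of 2, where 'a = real]
    by (subst summable_Suc_iff [where f = "\<lambda>k. inverse (real k ^ 2)"]) auto
  have hS: "(\<Sum>i\<in>{- int N..int N}. h i) \<le> S" for N
  proof -
    have sub: "{- int N..int N} \<subseteq> int ` {..N} \<union> (\<lambda>k. - int k) ` {..N}"
    proof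
      fix i assume "i \<in> {- int N..int N}"
      then have "i = int (nat i) \<and> nat i \<le> N \<or> i = - int (nat (- i)) \<and> nat (- i) \<le> N"
        by auto
      then show "i \<in> int ` {..N} \<union> (\<lambda>k. - int k) ` {..N}" by blast
    qed
    have "(\<Sum>i\<in>{- int N..int N}. h i) \<le> sum h (int ` {..N} \<union> (\<lambda>k. - int k) ` {..N})"
      by (rule sum_mono2) (use sub h0 in auto)
    also have "\<dots> \<le> sum h (int ` {..N}) + sum h ((\<lambda>k. - int k) ` {..N})"
      by (subst sum_Un) (auto intro!: sum_nonneg h0)
    also have "\<dots> = 2 * (\<Sum>k\<le>N. inverse (real (Suc k) ^ 2))"
      by (simp add: sum.reindex inj_on_def h_def add.commute)
    also have "\<dots> \<le> S"
      unfolding S_def using sum_le_suminf [OF sm, of "{..N}"] by simp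
    finally show ?thesis .
  qed
  show "bdd_above (sum (\<lambda>m :: int ^ 'n. inverse ((1 + lsize m) ^ (2 * CARD('n)))) `
          {F. F \<subseteq> UNIV \<and> finite F})"
  proof (rule bdd_aboveI2)
    fix F :: "(int ^ 'n) set" assume "F \<in> {F. F \<subseteq> UNIV \<and> finite F}"
    then have F: "finite F" by simp
    define N where "N = nat (Max (insert 0 ((\<lambda>(m, j). \<bar>m $ j\<bar>) ` (F \<times> UNIV))))"
    have N: "\<bar>m $ j\<bar> \<le> int N" if "m \<in> F" for m j
    proof -
      have "\<bar>m $ j\<bar> \<le> Max (insert 0 ((\<lambda>(m, j). \<bar>m $ j\<bar>) ` (F \<times> UNIV)))"
        by (rule Max_ge) (use F that in auto)
      then show ?thesis unfolding N_def by linarith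
    qed
    have w: "inverse ((1 + lsize m) ^ (2 * CARD('n))) \<le> (\<Prod>j\<in>UNIV. h (m $ j))"
      for m :: "int ^ 'n"
    proof -
      have "(\<Prod>j\<in>(UNIV::'n set). (1 + \<bar>real_of_int (m $ j)\<bar>)\<^sup>2) \<le> (\<Prod>j\<in>(UNIV::'n set). (1 + lsize m)\<^sup>2)"
        by (rule prod_mono) (auto intro!: power_mono lsize_component)
      also have "\<dots> = (1 + lsize m) ^ (2 * CARD('n))"
        by (simp add: power_mult)
      finally have le: "(\<Prod>j\<in>(UNIV::'n set). (1 + \<bar>real_of_int (m $ j)\<bar>)\<^sup>2) \<le> (1 + lsize m) ^ (2 * CARD('n))" .
      have "inverse ((1 + lsize m) ^ (2 * CARD('n)))
          \<le> inverse (\<Prod>j\<in>(UNIV::'n set). (1 + \<bar>real_of_int (m $ j)\<bar>)\<^sup>2)"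
        by (rule le_imp_inverse_le [OF le]) (intro prod_pos, auto intro!: zero_less_power add_pos_nonneg)
      also have "\<dots> = (\<Prod>j\<in>UNIV. h (m $ j))"
        unfolding h_def using prod_inversef [of "\<lambda>j. (1 + \<bar>real_of_int (m $ j)\<bar>)\<^sup>2" UNIV]
        by (simp only: o_def)
      finally show ?thesis .
    qed
    have "(\<Sum>m\<in>F. inverse ((1 + lsize m) ^ (2 * CARD('n)))) \<le> (\<Sum>m\<in>F. \<Prod>j\<in>UNIV. h (m $ j))"
      by (rule sum_mono) (rule w)
    also have "\<dots> = sum (\<lambda>f. \<Prod>j\<in>UNIV. h (f j)) (vec_nth ` F)"
      by (subst sum.reindex) (auto simp: inj_on_def vec_eq_iff)
    also have "\<dots> \<le> sum (\<lambda>f. \<Prod>j\<in>(UNIV::'n set). h (f j)) (PiE UNIV (\<lambda>_. {- int N..int N}))"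
    proof (rule sum_mono2)
      show "finite (PiE (UNIV::'n set) (\<lambda>_. {- int N..int N}))" by (rule finite_PiE) auto
      show "vec_nth ` F \<subseteq> PiE UNIV (\<lambda>_. {- int N..int N})"
        using N by (force simp: PiE_def abs_le_iff)
    qed (auto intro!: prod_nonneg h0)
    also have "\<dots> = (\<Prod>j\<in>(UNIV::'n set). \<Sum>i\<in>{- int N..int N}. h i)"
      by (subst prod_sum_PiE) auto
    also have "\<dots> \<le> (\<Prod>j\<in>(UNIV::'n set). S)"
      by (rule prod_mono) (auto intro!: sum_nonneg h0 hS)
    finally show "(\<Sum>m\<in>F. inverse ((1 + lsize m) ^ (2 * CARD('n)))) \<le> S ^ CARD('n)"
      by simp
  qed
qed simp

lemma rapidly_decreasing_obtain:
  assumes "rapidly_decreasing c"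
  obtains C where "0 \<le> C" "\<And>m. (1 + lsize m) ^ k * cmod (c m) \<le> C"
proof -
  obtain C where C: "\<And>m. (1 + lsize m) ^ k * cmod (c m) \<le> C"
    using assms unfolding rapidly_decreasing_def by blast
  have "0 \<le> C" by (rule order_trans [OF _ C [of 0]]) simp
  then show ?thesis using C that by blast
qed

lemma rapidly_decreasing_weighted_summable:
  fixes c :: "int ^ 'n::finite \<Rightarrow> complex"
  assumes "rapidly_decreasing c"
  shows "(\<lambda>m. (1 + lsize m) ^ k * cmod (c m)) summable_on UNIV"
proof -
  obtain C where C: "\<And>m. (1 + lsize m) ^ (2 * CARD('n) + k) * cmod (c m) \<le> C"
    using rapidly_decreasing_obtain [OF assms] by blast
  have le: "(1 + lsize m) ^ k * cmod (c m) \<le> C * inverse ((1 + lsize m) ^ (2 * CARD('n)))" for m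
  proof -
    have "0 < (1 + lsize m) ^ (2 * CARD('n))" by (simp add: add_pos_nonneg)
    then show ?thesis using C [of m] by (simp add: field_simps power_add)
  qed
  have "(\<lambda>m :: int ^ 'n. C * inverse ((1 + lsize m) ^ (2 * CARD('n)))) summable_on UNIV"
    by (intro summable_on_cmult_right summable_lattice_weight)
  then show ?thesis
    by (rule summable_on_comparison_test) (use le in auto)
qed

lemma rapidly_decreasing_finite:
  assumes "finite {m. c m \<noteq> 0}"
  shows "rapidly_decreasing c"
  unfolding rapidly_decreasing_def
proof
  fix k
  have "(1 + lsize m) ^ k * cmod (c m) \<le> (\<Sum>p | c p \<noteq> 0. (1 + lsize p) ^ k * cmod (c p))" for m
  proof (cases "c m = 0")
    case True then show ?thesis by (auto intro!: sum_nonneg)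
  next
    case False then show ?thesis by (intro member_le_sum) (use assms in auto)
  qed
  then show "\<exists>C. \<forall>m. (1 + lsize m) ^ k * cmod (c m) \<le> C" by blast
qed

lemma rapidly_decreasing_dominated:
  assumes "rapidly_decreasing c" and "\<And>m. cmod (d m) \<le> K * (1 + lsize m) ^ l * cmod (c (f m))"
    and "\<And>m. lsize (f m) = lsize m" and "0 \<le> K"
  shows "rapidly_decreasing d"
  unfolding rapidly_decreasing_def
proof
  fix k
  obtain C where C: "\<And>m. (1 + lsize m) ^ (k + l) * cmod (c m) \<le> C"
    using rapidly_decreasing_obtain [OF assms(1)] by blast
  have "(1 + lsize m) ^ k * cmod (d m) \<le> K * C" for m
  proof -
    have "(1 + lsize m) ^ k * cmod (d m) \<le> (1 + lsize m) ^ k * (K * (1 + lsize m) ^ l * cmod (c (f m)))"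
      by (intro mult_left_mono assms(2)) simp
    also have "\<dots> = K * ((1 + lsize (f m)) ^ (k + l) * cmod (c (f m)))"
      by (simp add: assms(3) power_add)
    also have "\<dots> \<le> K * C" by (intro mult_left_mono C assms)
    finally show ?thesis .
  qed
  then show "\<exists>C. \<forall>m. (1 + lsize m) ^ k * cmod (d m) \<le> C" by blast
qed

lemma rapidly_decreasing_add:
  assumes "rapidly_decreasing c" "rapidly_decreasing d"
  shows "rapidly_decreasing (\<lambda>m. c m + d m)"
  unfolding rapidly_decreasing_def
proof
  fix k
  obtain C D where CD: "\<And>m. (1 + lsize m) ^ k * cmod (c m) \<le> C" "\<And>m. (1 + lsize m) ^ k * cmod (d m) \<le> D"
    using assms unfolding rapidly_decreasing_def by meson
  have "(1 + lsize m) ^ k * cmod (c m + d m) \<le> C + D" for m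
  proof -
    have "(1 + lsize m) ^ k * cmod (c m + d m) \<le> (1 + lsize m) ^ k * (cmod (c m) + cmod (d m))"
      by (intro mult_left_mono norm_triangle_ineq) simp
    also have "\<dots> \<le> C + D" using CD [of m] by (simp add: distrib_left)
    finally show ?thesis .
  qed
  then show "\<exists>C. \<forall>m. (1 + lsize m) ^ k * cmod (c m + d m) \<le> C" by blast
qed

lemma rapidly_decreasing_twisted_convolution:
  fixes c d :: "int ^ 'n::finite \<Rightarrow> complex"
  assumes c: "rapidly_decreasing c" and d: "rapidly_decreasing d"
    and w: "\<And>m p. cmod (w m p) = 1"
  shows "rapidly_decreasing (\<lambda>p. \<Sum>\<^sub>\<infinity>m. c m * d (p - m) * w m p)"
  unfolding rapidly_decreasing_def
proof
  fix k
  obtain D where D: "0 \<le> D" "\<And>m. (1 + lsize m) ^ k * cmod (d m) \<le> D"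
    using rapidly_decreasing_obtain [OF d] by blast
  define A where "A = (\<Sum>\<^sub>\<infinity>m. (1 + lsize m) ^ k * cmod (c m))"
  have sA: "(\<lambda>m. D * ((1 + lsize m) ^ k * cmod (c m))) summable_on UNIV"
    by (intro summable_on_cmult_right rapidly_decreasing_weighted_summable c)
  have "(1 + lsize p) ^ k * cmod (\<Sum>\<^sub>\<infinity>m. c m * d (p - m) * w m p) \<le> D * A" for p
  proof -
    have le: "(1 + lsize p) ^ k * cmod (c m * d (p - m) * w m p)
        \<le> D * ((1 + lsize m) ^ k * cmod (c m))" for m
    proof -
      have "(1 + lsize p) ^ k \<le> ((1 + lsize m) * (1 + lsize (p - m))) ^ k"
        by (intro power_mono lsize_submult) simp
      then have "(1 + lsize p) ^ k * cmod (c m * d (p - m) * w m p)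
          \<le> ((1 + lsize m) * (1 + lsize (p - m))) ^ k * cmod (c m * d (p - m) * w m p)"
        by (intro mult_right_mono) simp_all
      also have "\<dots> = (1 + lsize m) ^ k * cmod (c m) * ((1 + lsize (p - m)) ^ k * cmod (d (p - m)))"
        by (simp add: norm_mult w power_mult_distrib)
      also have "\<dots> \<le> (1 + lsize m) ^ k * cmod (c m) * D"
        by (intro mult_left_mono D) simp
      finally show ?thesis by (simp add: mult_ac)
    qed
    have "(1 + lsize p) ^ k * cmod (\<Sum>\<^sub>\<infinity>m. c m * d (p - m) * w m p)
        = norm (\<Sum>\<^sub>\<infinity>m. of_real ((1 + lsize p) ^ k) * (c m * d (p - m) * w m p))"
      by (simp only: infsum_cmult_right' norm_mult norm_of_real abs_of_nonneg zero_le_power add_nonneg_nonneg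
          zero_le_one lsize_nonneg)
    also have "\<dots> \<le> (\<Sum>\<^sub>\<infinity>m. D * ((1 + lsize m) ^ k * cmod (c m)))"
    proof (rule norm_infsum_le)
      have "norm (of_real ((1 + lsize p) ^ k) * (c m * d (p - m) * w m p))
          \<le> D * ((1 + lsize m) ^ k * cmod (c m))" for m
        using le [of m] by (simp only: norm_mult norm_of_real) simp
      then show le': "\<And>m. m \<in> UNIV \<Longrightarrow> norm (of_real ((1 + lsize p) ^ k) * (c m * d (p - m) * w m p))
          \<le> D * ((1 + lsize m) ^ k * cmod (c m))" by blast
      have "(\<lambda>m. of_real ((1 + lsize p) ^ k) * (c m * d (p - m) * w m p)) summable_on UNIV"
        by (rule abs_summable_summable, rule Infinite_Sum.abs_summable_on_comparison_test' [OF sA])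
          (rule le')
      then show "((\<lambda>m. of_real ((1 + lsize p) ^ k) * (c m * d (p - m) * w m p)) has_sum
          (\<Sum>\<^sub>\<infinity>m. of_real ((1 + lsize p) ^ k) * (c m * d (p - m) * w m p))) UNIV"
        by (rule has_sum_infsum)
      show "((\<lambda>m. D * ((1 + lsize m) ^ k * cmod (c m))) has_sum
          (\<Sum>\<^sub>\<infinity>m. D * ((1 + lsize m) ^ k * cmod (c m)))) UNIV"
        by (intro has_sum_infsum sA)
    qed
    also have "\<dots> = D * A" unfolding A_def by (rule infsum_cmult_right')
    finally show ?thesis .
  qed
  then show "\<exists>C. \<forall>p. (1 + lsize p) ^ k * cmod (\<Sum>\<^sub>\<infinity>m. c m * d (p - m) * w m p) \<le> C" by blast
qed


section \<open>The smooth noncommutative torus\<close>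

text \<open>
  An element \<open>a\<close> of \<open>'n smooth_torus\<close> stands for the series
  \<open>\<Sum>m. fcoeff a m \<cdot> U\<^sup>m\<close>, where \<open>U\<^sup>m\<close> is the product of the
  \<open>U\<^sub>j ^ (m $ j)\<close> taken in increasing order of \<open>j\<close>.  The underlying vector space does
  not depend on \<open>\<Theta>\<close>; product and involution do.  The index set \<open>{1, \<dots>, n}\<close> is
  a finite linearly ordered type \<open>'n\<close>, the order being needed only for the normal form \<open>U\<^sup>m\<close>.
\<close>

typedef 'n smooth_torus = "{c :: int ^ 'n::finite \<Rightarrow> complex. rapidly_decreasing c}"
  morphisms fcoeff Abs_smooth_torus
  by (rule exI [of _ "\<lambda>_. 0"]) (simp add: rapidly_decreasing_finite)

type_synonym 'n theta = "((real, 'n) vec, 'n) vec"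

setup_lifting type_definition_smooth_torus

instantiation smooth_torus :: (finite) ab_group_add
begin

lift_definition zero_smooth_torus :: "'a smooth_torus" is "\<lambda>_. 0"
  by (simp add: rapidly_decreasing_finite)

lift_definition plus_smooth_torus :: "'a smooth_torus \<Rightarrow> 'a smooth_torus \<Rightarrow> 'a smooth_torus"
  is "\<lambda>a b m. a m + b m"
  by (rule rapidly_decreasing_add)

lift_definition uminus_smooth_torus :: "'a smooth_torus \<Rightarrow> 'a smooth_torus" is "\<lambda>a m. - a m"
  by (simp add: rapidly_decreasing_def)

definition minus_smooth_torus :: "'a smooth_torus \<Rightarrow> 'a smooth_torus \<Rightarrow> 'a smooth_torus" where
  "minus_smooth_torus a b = a + (- b)"

instance
proof
  fix a b c :: "'a smooth_torus"
  show "a + b + c = a + (b + c)" by transfer (simp add: add.assoc)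
  show "a + b = b + a" by transfer (simp add: add.commute)
  show "0 + a = a" by transfer simp
  show "- a + a = 0" by transfer simp
  show "a - b = a + - b" by (rule minus_smooth_torus_def)
qed

end

lift_definition cscale :: "complex \<Rightarrow> 'n::finite smooth_torus \<Rightarrow> 'n smooth_torus" (infixr "*\<^sub>c" 75)
  is "\<lambda>z a m. z * a m"
  by (rule rapidly_decreasing_dominated [where f = "\<lambda>m. m" and l = 0 and K = "cmod z" for z])
    (auto simp: norm_mult)

text \<open>\<open>nct_monom m\<close> is \<open>U\<^sup>m\<close>; the unit is \<open>nct_monom 0\<close> and \<open>U\<^sub>j\<close> is \<open>nct_monom (axis j 1)\<close>.\<close>

lift_definition nct_monom :: "int ^ 'n::finite \<Rightarrow> 'n smooth_torus" is "\<lambda>m p. if p = m then 1 else 0"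
  by (rule rapidly_decreasing_finite) simp

text \<open>
  From \<open>U\<^sub>j U\<^sub>k = exp (2 \<pi> i \<Theta>\<^sub>j\<^sub>k) U\<^sub>k U\<^sub>j\<close> one gets
  \<open>U\<^sup>m U\<^sup>q = nct_phase \<Theta> m q \<cdot> U\<^sup>m\<^sup>+\<^sup>q\<close>
  and hence \<open>(U\<^sup>m)\<^sup>* = nct_phase \<Theta> m m \<cdot> U\<^sup>-\<^sup>m\<close>.
\<close>

definition nct_phase :: "'n theta \<Rightarrow> (int, 'n) vec \<Rightarrow> (int, 'n::{finite,linorder}) vec \<Rightarrow> complex" where
  "nct_phase \<Theta> m q = cis (2 * pi * (\<Sum>j\<in>UNIV. \<Sum>k | k < j. \<Theta> $ j $ k * of_int (m $ j) * of_int (q $ k)))"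

lift_definition nct_mult ::
  "'n theta \<Rightarrow> 'n smooth_torus \<Rightarrow> 'n smooth_torus \<Rightarrow> 'n::{finite,linorder} smooth_torus"
  is "\<lambda>\<Theta> a b p. \<Sum>\<^sub>\<infinity>m. a m * b (p - m) * nct_phase \<Theta> m (p - m)"
  by (rule rapidly_decreasing_twisted_convolution) (simp_all add: nct_phase_def)

lift_definition nct_star :: "'n theta \<Rightarrow> 'n smooth_torus \<Rightarrow> 'n::{finite,linorder} smooth_torus"
  is "\<lambda>\<Theta> a p. cnj (a (- p)) * nct_phase \<Theta> p p"
  by (rule rapidly_decreasing_dominated [where f = uminus and l = 0 and K = 1])
    (auto simp: nct_phase_def norm_mult)

definition nct_trace :: "'n::finite smooth_torus \<Rightarrow> complex" where
  "nct_trace a = fcoeff a 0"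

text \<open>The generator of the one-parameter group \<open>U\<^sub>j \<mapsto> exp (2 \<pi> i s) U\<^sub>j\<close>.\<close>

lift_definition nct_partial :: "'n::finite \<Rightarrow> 'n smooth_torus \<Rightarrow> 'n smooth_torus"
  is "\<lambda>j a m. 2 * of_real pi * \<i> * of_int (m $ j) * a m"
proof -
  fix j :: 'n and a :: "int ^ 'n \<Rightarrow> complex"
  assume a: "rapidly_decreasing a"
  show "rapidly_decreasing (\<lambda>m. 2 * of_real pi * \<i> * of_int (m $ j) * a m)"
  proof (rule rapidly_decreasing_dominated [where f = "\<lambda>m. m" and l = 1 and K = "2 * pi", OF a])
    fix m :: "int ^ 'n"
    have "\<bar>real_of_int (m $ j)\<bar> \<le> 1 + lsize m" using lsize_component [of m j] by simp
    then show "cmod (2 * of_real pi * \<i> * of_int (m $ j) * a m)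
        \<le> 2 * pi * (1 + lsize m) ^ 1 * cmod (a m)"
      by (auto simp: norm_mult intro!: mult_right_mono mult_left_mono)
  qed auto
qed


section \<open>The C*-algebra and its positive elements\<close>

text \<open>
  \<open>A\<^sub>\<Theta>\<close> is the completion of the universal *-algebra on the unitaries \<open>U\<^sub>j\<close>, i.e. of the
  trigonometric polynomials, in the largest C*-seminorm.  (The supremum below is over a
  nonempty family bounded by the sum of the absolute values of the coefficients, since
  every C*-seminorm is at most \<open>1\<close> on the unitaries \<open>U\<^sup>m\<close>.)
\<close>

definition trig_polys :: "'n::finite smooth_torus set" where
  "trig_polys = {a. finite {m. fcoeff a m \<noteq> 0}}"

definition cstar_seminorm ::
  "'n theta \<Rightarrow> ('n::{finite,linorder} smooth_torus \<Rightarrow> real) \<Rightarrow> bool" where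
  "cstar_seminorm \<Theta> p \<longleftrightarrow>
     (\<forall>a\<in>trig_polys. 0 \<le> p a) \<and>
     (\<forall>a\<in>trig_polys. \<forall>b\<in>trig_polys. p (a + b) \<le> p a + p b) \<and>
     (\<forall>z. \<forall>a\<in>trig_polys. p (z *\<^sub>c a) = cmod z * p a) \<and>
     (\<forall>a\<in>trig_polys. \<forall>b\<in>trig_polys. p (nct_mult \<Theta> a b) \<le> p a * p b) \<and>
     (\<forall>a\<in>trig_polys. p (nct_mult \<Theta> (nct_star \<Theta> a) a) = (p a)\<^sup>2)"

definition cstar_norm :: "'n theta \<Rightarrow> 'n::{finite,linorder} smooth_torus \<Rightarrow> real" where
  "cstar_norm \<Theta> a = (SUP p\<in>{p. cstar_seminorm \<Theta> p}. p a)"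

lift_definition truncate :: "nat \<Rightarrow> 'n::finite smooth_torus \<Rightarrow> 'n smooth_torus"
  is "\<lambda>N a m. if lsize m \<le> real N then a m else 0"
  by (rule rapidly_decreasing_dominated [where f = "\<lambda>m. m" and l = 0 and K = 1]) auto

text \<open>
  \<open>a = b\<^sup>* b\<close> for some \<open>b\<close> in \<open>A\<^sub>\<Theta>\<close>.  Here \<open>b\<close> is given by a Cauchy sequence of
  trigonometric polynomials, and the smooth element \<open>a\<close> is the limit of its partial sums.
\<close>

definition cstar_positive :: "'n theta \<Rightarrow> 'n::{finite,linorder} smooth_torus \<Rightarrow> bool" where
  "cstar_positive \<Theta> a \<longleftrightarrow>
     (\<exists>b. (\<forall>k. b k \<in> trig_polys) \<and>
        (\<forall>\<epsilon>>0. \<exists>K. \<forall>k\<ge>K. \<forall>l\<ge>K. cstar_norm \<Theta> (b k - b l) < \<epsilon>) \<and>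
        (\<lambda>k. cstar_norm \<Theta> (truncate k a - nct_mult \<Theta> (nct_star \<Theta> (b k)) (b k))) \<longlonglongrightarrow> 0)"


section \<open>Derivations and the genericity condition\<close>

definition star_derivations ::
  "'n theta \<Rightarrow> ('n::{finite,linorder} smooth_torus \<Rightarrow> 'n smooth_torus) set" where
  "star_derivations \<Theta> = {\<delta>.
     (\<forall>a b. \<delta> (a + b) = \<delta> a + \<delta> b) \<and>
     (\<forall>z a. \<delta> (z *\<^sub>c a) = z *\<^sub>c \<delta> a) \<and>
     (\<forall>a b. \<delta> (nct_mult \<Theta> a b) = nct_mult \<Theta> (\<delta> a) b + nct_mult \<Theta> a (\<delta> b)) \<and>
     (\<forall>a. \<delta> (nct_star \<Theta> a) = nct_star \<Theta> (\<delta> a))}"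

definition nct_ad ::
  "'n theta \<Rightarrow> 'n smooth_torus \<Rightarrow> 'n::{finite,linorder} smooth_torus \<Rightarrow> 'n smooth_torus" where
  "nct_ad \<Theta> a b = nct_mult \<Theta> a b - nct_mult \<Theta> b a"

text \<open>
  \<open>U\<^sub>j U\<^sup>m = cis (2 \<pi> (\<Theta> m)\<^sub>j) U\<^sup>m U\<^sub>j\<close>, so the condition says that no nonzero \<open>U\<^sup>m\<close> comes
  closer to being central than polynomially in \<open>m\<close>.  This is the small-divisor condition under
  which, for \<open>\<delta> (U\<^sub>j) = \<Sum>m. c j m \<cdot> U\<^sup>m U\<^sub>j\<close>, the solution \<open>b\<close> of \<open>\<delta> = ad b\<close> off the zero mode
  again has rapidly decreasing coefficients.
\<close>

definition generically_transcendental :: "'n::finite theta \<Rightarrow> bool" where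
  "generically_transcendental \<Theta> \<longleftrightarrow>
     (\<exists>C>0. \<exists>N::nat. \<forall>m :: int ^ 'n. m \<noteq> 0 \<longrightarrow>
        (\<exists>j. C / (1 + lsize m) ^ N \<le>
           cmod (cis (2 * pi * (\<Sum>k\<in>UNIV. \<Theta> $ j $ k * of_int (m $ k))) - 1)))"


section \<open>Vector fields, metrics, connections\<close>

text \<open>The vector field with components \<open>X $ j\<close> is \<open>\<Sum>j. X $ j \<cdot> \<partial>\<^sub>j\<close>.\<close>

type_synonym 'n vfield = "('n smooth_torus) ^ 'n"

definition vf_partial :: "'n::finite \<Rightarrow> 'n vfield" where
  "vf_partial j = axis j (nct_monom 0)"

definition vf_mult ::
  "'n theta \<Rightarrow> 'n smooth_torus \<Rightarrow> 'n::{finite,linorder} vfield \<Rightarrow> 'n vfield" where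
  "vf_mult \<Theta> a X = (\<chi> j. nct_mult \<Theta> a (X $ j))"

definition vf_cscale :: "complex \<Rightarrow> 'n::finite vfield \<Rightarrow> 'n vfield" where
  "vf_cscale z X = (\<chi> j. z *\<^sub>c (X $ j))"

definition riemannian_metric ::
  "'n theta \<Rightarrow> ('n::{finite,linorder} vfield \<Rightarrow> 'n vfield \<Rightarrow> 'n smooth_torus) \<Rightarrow> bool" where
  "riemannian_metric \<Theta> g \<longleftrightarrow>
     (\<forall>X Y Y'. g X (Y + Y') = g X Y + g X Y') \<and>
     (\<forall>z X Y. g (vf_cscale z X) Y = z *\<^sub>c g X Y \<and> g X (vf_cscale z Y) = cnj z *\<^sub>c g X Y) \<and>
     (\<forall>X X' Y. g (X + X') Y = g X Y + g X' Y) \<and>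
     (\<forall>a X Y. g (vf_mult \<Theta> a X) Y = nct_mult \<Theta> a (g X Y)) \<and>
     (\<forall>X Y. nct_star \<Theta> (g X Y) = g Y X) \<and>
     (\<forall>X. cstar_positive \<Theta> (g X X) \<and> (g X X = 0 \<longrightarrow> X = 0)) \<and>
     (\<forall>j k. nct_star \<Theta> (g (vf_partial j) (vf_partial k)) = g (vf_partial j) (vf_partial k))"

text \<open>
  Every left-linear functional on vector fields is \<open>\<langle>\<cdot>, Y\<rangle>\<close> for some vector field \<open>Y\<close>, i.e. the
  Gram matrix is invertible over the smooth torus.  Positive definiteness of
  \<open>riemannian_metric\<close> does not imply this: for \<open>h = 2 - U\<^sub>1 - U\<^sub>1\<^sup>*\<close> the form
  \<open>\<langle>X, Y\<rangle> = \<Sum>j. X\<^sub>j h Y\<^sub>j\<^sup>*\<close> is positive definite because \<open>h\<close> is positive and not a zero divisor,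
  but \<open>h\<close> is not invertible.
\<close>

definition nondegenerate_metric ::
  "'n theta \<Rightarrow> ('n::{finite,linorder} vfield \<Rightarrow> 'n vfield \<Rightarrow> 'n smooth_torus) \<Rightarrow> bool" where
  "nondegenerate_metric \<Theta> g \<longleftrightarrow>
     (\<forall>\<phi>. (\<forall>X X'. \<phi> (X + X') = \<phi> X + \<phi> X') \<and> (\<forall>a X. \<phi> (vf_mult \<Theta> a X) = nct_mult \<Theta> a (\<phi> X))
        \<longrightarrow> (\<exists>Y. \<forall>X. \<phi> X = g X Y))"

text \<open>
  The first argument of a connection ranges over the *-derivations only; \<open>extensional\<close> pins
  down the irrelevant values elsewhere, so that equality of connections is equality of maps.
  The *-derivations form a real vector space: the clauses on \<open>z\<delta>\<close> and on \<open>ad a\<close> apply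
  whenever these are *-derivations.
\<close>

definition connection ::
  "'n theta \<Rightarrow> ('n::{finite,linorder} vfield \<Rightarrow> 'n vfield \<Rightarrow> 'n smooth_torus) \<Rightarrow>
   (('n smooth_torus \<Rightarrow> 'n smooth_torus) \<Rightarrow> 'n vfield \<Rightarrow> 'n vfield) \<Rightarrow> bool" where
  "connection \<Theta> g D \<longleftrightarrow>
     D \<in> extensional (star_derivations \<Theta>) \<and>
     (\<forall>z. \<forall>\<delta>\<in>star_derivations \<Theta>. (\<lambda>a. z *\<^sub>c \<delta> a) \<in> star_derivations \<Theta> \<longrightarrow>
        (\<forall>Y. D (\<lambda>a. z *\<^sub>c \<delta> a) Y = vf_cscale z (D \<delta> Y))) \<and>
     (\<forall>\<delta>\<in>star_derivations \<Theta>. \<forall>\<delta>'\<in>star_derivations \<Theta>. \<forall>Y.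
        D (\<lambda>a. \<delta> a + \<delta>' a) Y = D \<delta> Y + D \<delta>' Y) \<and>
     (\<forall>\<delta>\<in>star_derivations \<Theta>. \<forall>Y Y' z.
        D \<delta> (Y + Y') = D \<delta> Y + D \<delta> Y' \<and> D \<delta> (vf_cscale z Y) = vf_cscale z (D \<delta> Y)) \<and>
     (\<forall>\<delta>\<in>star_derivations \<Theta>. \<forall>a Y.
        D \<delta> (vf_mult \<Theta> a Y) = vf_mult \<Theta> (\<delta> a) Y + vf_mult \<Theta> a (D \<delta> Y)) \<and>
     (\<forall>a. nct_trace a = 0 \<and> nct_ad \<Theta> a \<in> star_derivations \<Theta> \<longrightarrow>
        (\<forall>Y. D (nct_ad \<Theta> a) Y = vf_mult \<Theta> a Y)) \<and>
     (\<forall>j k l. nct_star \<Theta> (g (D (nct_partial j) (vf_partial k)) (vf_partial l))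
        = g (D (nct_partial j) (vf_partial k)) (vf_partial l))"

definition torsion_free ::
  "(('n::finite smooth_torus \<Rightarrow> 'n smooth_torus) \<Rightarrow> 'n vfield \<Rightarrow> 'n vfield) \<Rightarrow> bool" where
  "torsion_free D \<longleftrightarrow>
     (\<forall>j k. D (nct_partial j) (vf_partial k) = D (nct_partial k) (vf_partial j))"

definition metric_compatible ::
  "'n theta \<Rightarrow> ('n::{finite,linorder} vfield \<Rightarrow> 'n vfield \<Rightarrow> 'n smooth_torus) \<Rightarrow>
   (('n smooth_torus \<Rightarrow> 'n smooth_torus) \<Rightarrow> 'n vfield \<Rightarrow> 'n vfield) \<Rightarrow> bool" where
  "metric_compatible \<Theta> g D \<longleftrightarrow>
     (\<forall>\<delta>\<in>star_derivations \<Theta>. \<forall>X Y. \<delta> (g X Y) = g (D \<delta> X) Y + g X (D \<delta> Y))"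

definition levi_civita ::
  "'n theta \<Rightarrow> ('n::{finite,linorder} vfield \<Rightarrow> 'n vfield \<Rightarrow> 'n smooth_torus) \<Rightarrow>
   (('n smooth_torus \<Rightarrow> 'n smooth_torus) \<Rightarrow> 'n vfield \<Rightarrow> 'n vfield) \<Rightarrow> bool" where
  "levi_civita \<Theta> g D \<longleftrightarrow> connection \<Theta> g D \<and> torsion_free D \<and> metric_compatible \<Theta> g D"

end

theory Submission
  imports Defs
begin

text \<open>
  Conjugation by \<open>U\<^sub>j\<close> multiplies the mode \<open>U\<^sup>m\<close> by \<open>\<lambda>\<^sub>j(m) = cis (2 \<pi> (\<Theta> m)\<^sub>j)\<close>, and for generic \<open>\<Theta>\<close> some
  \<open>1 - \<lambda>\<^sub>j(m)\<close> is bounded below by a negative power of \<open>1 + \<bar>m\<bar>\<close>.  Dividing by these numbers writes every element as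
  a scalar plus a sum of terms \<open>r - U\<^sub>j r U\<^sub>j\<^sup>*\<close>.  A derivation \<open>\<delta>\<close> that kills all \<open>U\<^sub>j\<close> commutes with these
  conjugations, so that \<open>\<tau> \<circ> \<delta> = 0\<close> and then \<open>\<delta> = 0\<close>.  The same
  division solves \<open>[b, U\<^sub>j] = \<delta>(U\<^sub>j)\<close> off the zero mode, which gives the theorem of Bratteli, Elliott and
  Jorgensen: \<open>\<delta>\<close> is uniquely \<open>\<Sum>\<^sub>j c\<^sub>j \<partial>\<^sub>j + ad b\<close> with \<open>\<tau>(b) = 0\<close>, and for *-derivations \<open>c\<^sub>j\<close> is real and
  \<open>b\<^sup>* = - b\<close>.  A connection is therefore determined by the \<open>\<nabla>\<^sub>j \<partial>\<^sub>k\<close>, and since all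
  \<open>\<langle>\<nabla>\<^sub>j \<partial>\<^sub>k, \<partial>\<^sub>l\<rangle>\<close> are self-adjoint, the classical Koszul argument applies to them.
\<close>

section \<open>The twisted convolution algebra\<close>

lemma smooth_torus_eqI: "(\<And>m. fcoeff a m = fcoeff b m) \<Longrightarrow> a = b"
  by (simp add: fcoeff_inject [symmetric] fun_eq_iff)

lemma rapidly_decreasing_fcoeff [simp]: "rapidly_decreasing (fcoeff a)"
  using fcoeff by auto

lemma fcoeff_zero [simp]: "fcoeff 0 m = 0"
  by transfer simp

lemma fcoeff_plus [simp]: "fcoeff (a + b) m = fcoeff a m + fcoeff b m"
  by transfer simp

lemma fcoeff_uminus [simp]: "fcoeff (- a) m = - fcoeff a m"
  by transfer simp

lemma fcoeff_minus [simp]: "fcoeff (a - b) m = fcoeff a m - fcoeff b m"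
  unfolding minus_smooth_torus_def fcoeff_plus fcoeff_uminus by simp

lemma fcoeff_sum [simp]: "fcoeff (sum f A) m = (\<Sum>x\<in>A. fcoeff (f x) m)"
  by (induction A rule: infinite_finite_induct) auto

lemma fcoeff_cscale [simp]: "fcoeff (z *\<^sub>c a) m = z * fcoeff a m"
  by transfer simp

lemma fcoeff_monom: "fcoeff (nct_monom m) p = (if p = m then 1 else 0)"
  by transfer simp

lemma fcoeff_star: "fcoeff (nct_star \<Theta> a) p = cnj (fcoeff a (- p)) * nct_phase \<Theta> p p"
  by transfer simp

lemma fcoeff_mult:
  "fcoeff (nct_mult \<Theta> a b) p = (\<Sum>\<^sub>\<infinity>m. fcoeff a m * fcoeff b (p - m) * nct_phase \<Theta> m (p - m))"
  by transfer simp

lemma fcoeff_partial [simp]: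
  "fcoeff (nct_partial j a) m = 2 * of_real pi * \<i> * of_int (m $ j) * fcoeff a m"
  by transfer simp

lemma cscale_add_right: "z *\<^sub>c (a + b) = z *\<^sub>c a + z *\<^sub>c b"
  and cscale_add_left: "(z + w) *\<^sub>c a = z *\<^sub>c a + w *\<^sub>c a"
  and cscale_diff_right: "z *\<^sub>c (a - b) = z *\<^sub>c a - z *\<^sub>c b"
  and cscale_cscale: "z *\<^sub>c (w *\<^sub>c a) = (z * w) *\<^sub>c a"
  and cscale_zero_left [simp]: "0 *\<^sub>c a = 0"
  and cscale_zero_right [simp]: "z *\<^sub>c 0 = 0"
  and cscale_one [simp]: "1 *\<^sub>c a = a"
  by (auto intro!: smooth_torus_eqI simp: algebra_simps)

lemma cscale_sum_right: "z *\<^sub>c sum f A = (\<Sum>x\<in>A. z *\<^sub>c f x)"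
  by (rule smooth_torus_eqI) (simp add: sum_distrib_left)

section \<open>The phase as a bicharacter of the lattice\<close>

lemma nct_phase_zero [simp]: "nct_phase \<Theta> 0 q = 1" "nct_phase \<Theta> m 0 = 1"
  by (simp_all add: nct_phase_def)

lemma nct_phase_add_left: "nct_phase \<Theta> (m + m') q = nct_phase \<Theta> m q * nct_phase \<Theta> m' q"
  by (simp add: nct_phase_def cis_mult distrib_left distrib_right sum.distrib algebra_simps)

lemma nct_phase_add_right: "nct_phase \<Theta> m (q + q') = nct_phase \<Theta> m q * nct_phase \<Theta> m q'"
  by (simp add: nct_phase_def cis_mult distrib_left distrib_right sum.distrib algebra_simps)

lemma norm_nct_phase [simp]: "cmod (nct_phase \<Theta> m q) = 1"
  by (simp add: nct_phase_def)

lemma nct_phase_nonzero [simp]: "nct_phase \<Theta> m q \<noteq> 0"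
  by (simp add: nct_phase_def)

lemma nct_phase_minus_left: "nct_phase \<Theta> (- m) q = inverse (nct_phase \<Theta> m q)"
  using nct_phase_add_left [of \<Theta> "- m" m q]
  by (metis add.left_inverse inverse_unique mult.commute nct_phase_zero(1))

lemma nct_phase_minus_right: "nct_phase \<Theta> m (- q) = inverse (nct_phase \<Theta> m q)"
  using nct_phase_add_right [of \<Theta> m "- q" q]
  by (metis add.left_inverse inverse_unique mult.commute nct_phase_zero(2))

lemma nct_phase_diff_left: "nct_phase \<Theta> (m - m') q = nct_phase \<Theta> m q / nct_phase \<Theta> m' q"
  using nct_phase_add_left [of \<Theta> m "- m'" q] by (simp add: nct_phase_minus_left divide_inverse)

lemma nct_phase_diff_right: "nct_phase \<Theta> m (q - q') = nct_phase \<Theta> m q / nct_phase \<Theta> m q'"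
  using nct_phase_add_right [of \<Theta> m q "- q'"] by (simp add: nct_phase_minus_right divide_inverse)

lemma cnj_nct_phase: "cnj (nct_phase \<Theta> m q) = inverse (nct_phase \<Theta> m q)"
  by (simp add: nct_phase_def cis_cnj)

lemmas nct_phase_simps = nct_phase_add_left nct_phase_add_right nct_phase_minus_left
  nct_phase_minus_right nct_phase_diff_left nct_phase_diff_right cnj_nct_phase

section \<open>Convergence and ring laws of the twisted product\<close>

lemma fcoeff_abs_summable: "(\<lambda>m. cmod (fcoeff a m)) summable_on UNIV"
  using rapidly_decreasing_weighted_summable [of "fcoeff a" 0] by simp

lemma fcoeff_bounded: obtains C where "\<And>m. cmod (fcoeff a m) \<le> C"
  using rapidly_decreasing_obtain [of "fcoeff a" 0] by (metis rapidly_decreasing_fcoeff mult_1 power_0)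

lemma bij_diff_lattice: "bij_betw (\<lambda>q. q - p) UNIV (UNIV :: (int ^ 'n) set)"
  by (rule bij_betw_byWitness [where f' = "\<lambda>q. q + p"]) auto

text \<open>One factor is absolutely summable, the other bounded, and the phase has modulus
  1.\<close>

lemma summable_mult:
  fixes a b :: "'n::{finite,linorder} smooth_torus"
  shows "(\<lambda>m. fcoeff a m * fcoeff b (p - m) * nct_phase \<Theta> m (p - m)) summable_on UNIV"
proof -
  obtain C where C: "\<And>m. cmod (fcoeff b m) \<le> C" using fcoeff_bounded by blast
  have "(\<lambda>m. cmod (fcoeff a m) * C) summable_on UNIV"
    by (intro summable_on_cmult_left fcoeff_abs_summable)
  then have "(\<lambda>m. norm (fcoeff a m * fcoeff b (p - m) * nct_phase \<Theta> m (p - m))) summable_on UNIV"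
    by (rule Infinite_Sum.abs_summable_on_comparison_test')
      (auto simp: norm_mult intro!: mult_left_mono C)
  then show ?thesis by (rule abs_summable_summable)
qed

lemma nct_mult_add_left: "nct_mult \<Theta> (a + b) c = nct_mult \<Theta> a c + nct_mult \<Theta> b c"
  by (rule smooth_torus_eqI) (simp add: fcoeff_mult distrib_right infsum_add summable_mult)

lemma nct_mult_add_right: "nct_mult \<Theta> a (b + c) = nct_mult \<Theta> a b + nct_mult \<Theta> a c"
  by (rule smooth_torus_eqI)
    (simp add: fcoeff_mult distrib_left distrib_right infsum_add summable_mult)

lemma nct_mult_cscale_left [simp]: "nct_mult \<Theta> (z *\<^sub>c a) b = z *\<^sub>c nct_mult \<Theta> a b"
  by (rule smooth_torus_eqI) (simp add: fcoeff_mult infsum_cmult_right' [symmetric] mult_ac)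

lemma nct_mult_cscale_right [simp]: "nct_mult \<Theta> a (z *\<^sub>c b) = z *\<^sub>c nct_mult \<Theta> a b"
  by (rule smooth_torus_eqI) (simp add: fcoeff_mult infsum_cmult_right' [symmetric] mult_ac)

lemma fcoeff_monom_mult:
  "fcoeff (nct_mult \<Theta> (nct_monom q) b) p = fcoeff b (p - q) * nct_phase \<Theta> q (p - q)"
proof -
  have "fcoeff (nct_mult \<Theta> (nct_monom q) b) p
      = (\<Sum>\<^sub>\<infinity>m\<in>{q}. fcoeff b (p - m) * nct_phase \<Theta> m (p - m))"
    unfolding fcoeff_mult by (rule infsum_cong_neutral) (auto simp: fcoeff_monom)
  then show ?thesis by simp
qed

lemma fcoeff_mult_monom:
  "fcoeff (nct_mult \<Theta> b (nct_monom q)) p = fcoeff b (p - q) * nct_phase \<Theta> (p - q) q"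
proof -
  have "fcoeff (nct_mult \<Theta> b (nct_monom q)) p
      = (\<Sum>\<^sub>\<infinity>m\<in>{p - q}. fcoeff b m * nct_phase \<Theta> m (p - m))"
    unfolding fcoeff_mult by (rule infsum_cong_neutral) (auto simp: fcoeff_monom)
  then show ?thesis by simp
qed

lemma nct_mult_one_left: "nct_mult \<Theta> (nct_monom 0) a = a"
  by (rule smooth_torus_eqI) (simp add: fcoeff_monom_mult)

lemma nct_mult_one_right: "nct_mult \<Theta> a (nct_monom 0) = a"
  by (rule smooth_torus_eqI) (simp add: fcoeff_mult_monom)

text \<open>Both sides are the same double series, summed in different orders; the phases match
  because a bicharacter satisfies the 2-cocycle identity.\<close>

lemma nct_mult_assoc:
  fixes a b c :: "'n::{finite,linorder} smooth_torus"
  shows "nct_mult \<Theta> (nct_mult \<Theta> a b) c = nct_mult \<Theta> a (nct_mult \<Theta> b c)"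
proof (rule smooth_torus_eqI)
  fix p
  \<comment> \<open>Written with the phases of the right-hand bracketing; \<open>phase\<close> below
    converts them to those of the left-hand one.\<close>
  define F where "F m k = fcoeff a k * fcoeff b (m - k) * fcoeff c (p - m) *
      (nct_phase \<Theta> k (p - k) * nct_phase \<Theta> (m - k) (p - m))" for m k
  obtain C where C: "\<And>m. cmod (fcoeff c m) \<le> C" using fcoeff_bounded by blast
  have "(\<lambda>(k, m). F m k) summable_on (UNIV \<times> UNIV)"
  proof -
    obtain B where B: "((\<lambda>m. cmod (fcoeff b m)) has_sum B) UNIV"
      using fcoeff_abs_summable summable_iff_has_sum_infsum by blast
    have "(\<lambda>(k, m). cmod (fcoeff a k) * cmod (fcoeff b m)) summable_on (UNIV \<times> UNIV)"
      by (rule summable_on_SigmaI [where g = "\<lambda>k. cmod (fcoeff a k) * B"])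
        (auto intro!: has_sum_cmult_right B summable_on_cmult_left fcoeff_abs_summable)
    then have s: "(\<lambda>(k, m). cmod (fcoeff a k) * cmod (fcoeff b m) * C) summable_on (UNIV \<times> UNIV)"
      using summable_on_cmult_left [of "\<lambda>x. cmod (fcoeff a (fst x)) * cmod (fcoeff b (snd x))" _ C]
      by (simp add: case_prod_unfold)
    \<comment> \<open>The shear (k, m) to (k, m - k) turns the convolution majorant into a product
      of two summable families.\<close>
    have bij: "bij_betw (\<lambda>(k, m). (k, m - k)) (UNIV \<times> UNIV) (UNIV \<times> (UNIV :: (int ^ 'n::{finite,linorder}) set))"
      by (rule bij_betw_byWitness [where f' = "\<lambda>(k, m). (k, m + k)"]) auto
    have "(\<lambda>(k, m). cmod (fcoeff a k) * cmod (fcoeff b (m - k)) * C) summable_on (UNIV \<times> UNIV)"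
      using summable_on_reindex_bij_betw [OF bij, THEN iffD2, OF s] by (simp add: case_prod_unfold)
    then have "(\<lambda>x. norm (case x of (k, m) \<Rightarrow> F m k)) summable_on (UNIV \<times> UNIV)"
      by (rule Infinite_Sum.abs_summable_on_comparison_test')
        (auto simp: F_def norm_mult intro!: mult_left_mono C)
    then show ?thesis by (rule abs_summable_summable)
  qed
  then have swap: "(\<Sum>\<^sub>\<infinity>k. \<Sum>\<^sub>\<infinity>m. F m k) = (\<Sum>\<^sub>\<infinity>m. \<Sum>\<^sub>\<infinity>k. F m k)"
    by (rule infsum_swap_banach)
  have phase: "nct_phase \<Theta> k (m - k) * nct_phase \<Theta> m (p - m)
      = nct_phase \<Theta> k (p - k) * nct_phase \<Theta> (m - k) (p - m)" for k m
    using nct_phase_add_left [of \<Theta> k "m - k" "p - m"] nct_phase_add_right [of \<Theta> k "m - k" "p - m"]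
    by simp
  have F: "F m k = fcoeff a k * fcoeff b (m - k) * nct_phase \<Theta> k (m - k) * fcoeff c (p - m)
      * nct_phase \<Theta> m (p - m)" for m k
    unfolding F_def phase [symmetric] by (simp only: mult_ac)
  have "fcoeff (nct_mult \<Theta> (nct_mult \<Theta> a b) c) p = (\<Sum>\<^sub>\<infinity>m. \<Sum>\<^sub>\<infinity>k. F m k)"
    unfolding fcoeff_mult F infsum_cmult_left' [symmetric] ..
  also have "\<dots> = (\<Sum>\<^sub>\<infinity>k. \<Sum>\<^sub>\<infinity>m. F m k)" by (rule swap [symmetric])
  also have "\<dots> = fcoeff (nct_mult \<Theta> a (nct_mult \<Theta> b c)) p"
    unfolding fcoeff_mult
  proof (rule infsum_cong)
    fix k
    \<comment> \<open>\<open>G\<close> is the summand of the product of b and c at mode p - k; up to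
      a factor depending on k alone, \<open>F\<close> is its shift by k.\<close>
    define G where "G m = fcoeff b m * fcoeff c (p - k - m) * nct_phase \<Theta> m (p - k - m)" for m
    have "(\<Sum>\<^sub>\<infinity>m. F m k) = (\<Sum>\<^sub>\<infinity>m. (fcoeff a k * nct_phase \<Theta> k (p - k)) * G (m - k))"
    proof (rule infsum_cong)
      fix m
      have e: "p - k - (m - k) = p - m" by simp
      show "F m k = (fcoeff a k * nct_phase \<Theta> k (p - k)) * G (m - k)"
        unfolding F_def G_def e by (simp only: mult_ac)
    qed
    also have "\<dots> = (fcoeff a k * nct_phase \<Theta> k (p - k)) * (\<Sum>\<^sub>\<infinity>m. G (m - k))"
      by (rule infsum_cmult_right')
    also have "(\<Sum>\<^sub>\<infinity>m. G (m - k)) = (\<Sum>\<^sub>\<infinity>m. G m)"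
      by (rule infsum_reindex_bij_betw [OF bij_diff_lattice])
    finally show "(\<Sum>\<^sub>\<infinity>m. F m k)
        = fcoeff a k * (\<Sum>\<^sub>\<infinity>m. fcoeff b m * fcoeff c (p - k - m) * nct_phase \<Theta> m (p - k - m))
          * nct_phase \<Theta> k (p - k)"
      unfolding G_def by (simp only: mult_ac)
  qed
  finally show "fcoeff (nct_mult \<Theta> (nct_mult \<Theta> a b) c) p = fcoeff (nct_mult \<Theta> a (nct_mult \<Theta> b c)) p" .
qed

text \<open>The product depends on the parameter \<Theta>, so the ring laws come from an
  interpretation valid for every \<Theta> instead of a type class instance.\<close>

global_interpretation nct: ring "(+)" "0 :: 'n::{finite,linorder} smooth_torus" "(-)" uminus "nct_mult \<Theta>"
  for \<Theta> :: "'n::{finite,linorder} theta"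
  by unfold_locales (simp_all only: nct_mult_assoc nct_mult_add_left nct_mult_add_right)

section \<open>The involution and the basic derivations\<close>

text \<open>Shifting the summation index by p matches the two series term by term; the phases agree
  by bimultiplicativity.\<close>

lemma nct_star_mult: "nct_star \<Theta> (nct_mult \<Theta> a b) = nct_mult \<Theta> (nct_star \<Theta> b) (nct_star \<Theta> a)"
proof (rule smooth_torus_eqI)
  fix p
  show "fcoeff (nct_star \<Theta> (nct_mult \<Theta> a b)) p
      = fcoeff (nct_mult \<Theta> (nct_star \<Theta> b) (nct_star \<Theta> a)) p"
    unfolding fcoeff_star fcoeff_mult infsum_cnj [symmetric] infsum_cmult_left' [symmetric]
    by (subst infsum_reindex_bij_betw [OF bij_diff_lattice [of p], symmetric])
      (intro infsum_cong, simp add: nct_phase_simps field_simps)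
qed

lemma nct_star_star [simp]: "nct_star \<Theta> (nct_star \<Theta> a) = a"
  by (rule smooth_torus_eqI) (simp add: fcoeff_star nct_phase_simps)

lemma nct_star_add: "nct_star \<Theta> (a + b) = nct_star \<Theta> a + nct_star \<Theta> b"
  and nct_star_diff: "nct_star \<Theta> (a - b) = nct_star \<Theta> a - nct_star \<Theta> b"
  and nct_star_cscale: "nct_star \<Theta> (z *\<^sub>c a) = cnj z *\<^sub>c nct_star \<Theta> a"
  and nct_star_zero [simp]: "nct_star \<Theta> 0 = 0"
  by (auto intro!: smooth_torus_eqI simp: fcoeff_star algebra_simps)

text \<open>In each term contributing to mode p the exponents add up to p, so the factor p_j splits
  into m_j and (p - m)_j.\<close>

lemma nct_partial_mult:
  "nct_partial j (nct_mult \<Theta> a b) = nct_mult \<Theta> (nct_partial j a) b + nct_mult \<Theta> a (nct_partial j b)"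
proof (rule smooth_torus_eqI)
  fix p
  show "fcoeff (nct_partial j (nct_mult \<Theta> a b)) p
      = fcoeff (nct_mult \<Theta> (nct_partial j a) b + nct_mult \<Theta> a (nct_partial j b)) p"
    unfolding fcoeff_plus fcoeff_partial [of j "nct_mult \<Theta> a b"] fcoeff_mult
      infsum_add [OF summable_mult summable_mult, symmetric] infsum_cmult_right' [symmetric]
    by (intro infsum_cong) (simp add: algebra_simps)
qed

lemma nct_partial_star_derivation: "nct_partial j \<in> star_derivations \<Theta>"
  unfolding star_derivations_def
  by (auto simp: nct_partial_mult fcoeff_star algebra_simps intro!: smooth_torus_eqI)

section \<open>Derivations for generic parameters\<close>

definition twist :: "'n::finite theta \<Rightarrow> 'n \<Rightarrow> int ^ 'n \<Rightarrow> complex" where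
  "twist \<Theta> j m = cis (2 * pi * (\<Sum>k\<in>UNIV. \<Theta> $ j $ k * of_int (m $ k)))"

lemma twist_zero [simp]: "twist \<Theta> j 0 = 1"
  by (simp add: twist_def)

text \<open>For skew-symmetric \<Theta> this is conjugation of a by U_j. It is defined mode by mode,
  so that its eigenvalues are visible and rapid decrease is immediate.\<close>

lift_definition nct_twist :: "'n theta \<Rightarrow> 'n \<Rightarrow> 'n smooth_torus \<Rightarrow> 'n::finite smooth_torus"
  is "\<lambda>\<Theta> j a m. twist \<Theta> j m * a m"
  by (rule rapidly_decreasing_dominated [where f = "\<lambda>m. m" and l = 0 and K = 1])
    (auto simp: norm_mult twist_def)

lemma fcoeff_twist [simp]: "fcoeff (nct_twist \<Theta> j a) m = twist \<Theta> j m * fcoeff a m"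
  by transfer simp

lemma nct_monom_star_right: "nct_mult \<Theta> (nct_monom m) (nct_star \<Theta> (nct_monom m)) = nct_monom 0"
  by (rule smooth_torus_eqI) (auto simp: fcoeff_monom_mult fcoeff_star fcoeff_monom nct_phase_simps)

lemma nct_monom_star_left: "nct_mult \<Theta> (nct_star \<Theta> (nct_monom m)) (nct_monom m) = nct_monom 0"
  by (rule smooth_torus_eqI) (auto simp: fcoeff_mult_monom fcoeff_star fcoeff_monom nct_phase_simps)

lemma nct_mult_monom_cancel:
  assumes "nct_mult \<Theta> a (nct_monom m) = nct_mult \<Theta> b (nct_monom m)"
  shows "a = b"
  by (metis assms nct_monom_star_right nct_mult_assoc nct_mult_one_right)

lemma nct_monom_mult: "nct_mult \<Theta> (nct_monom m) (nct_monom q) = nct_phase \<Theta> m q *\<^sub>c nct_monom (m + q)"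
  by (rule smooth_torus_eqI) (auto simp: fcoeff_monom_mult fcoeff_monom algebra_simps)

text \<open>In normal order the left phase collects the entries of row j with k < j, the right one
  minus those with k > j. As the diagonal vanishes, their quotient has the full row sum as
  exponent.\<close>

lemma nct_phase_axis:
  fixes \<Theta> :: "'n::{finite,linorder} theta"
  assumes skew: "transpose \<Theta> = - \<Theta>"
  shows "nct_phase \<Theta> (axis j 1) m = twist \<Theta> j m * nct_phase \<Theta> m (axis j 1)"
proof -
  have sk: "\<Theta> $ k $ l = - \<Theta> $ l $ k" for k l
    using arg_cong [OF skew, of "\<lambda>A. A $ l $ k"] by (simp add: transpose_def)
  have diag: "\<Theta> $ j $ j = 0" using sk [of j j] by simp
  let ?t = "\<lambda>k. \<Theta> $ j $ k * of_int (m $ k)"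
  have L: "(\<Sum>i\<in>UNIV. \<Sum>k | k < i. \<Theta> $ i $ k * of_int (axis j 1 $ i) * of_int (m $ k))
      = (\<Sum>k | k < j. ?t k)"
  proof -
    have "(\<Sum>i\<in>UNIV. \<Sum>k | k < i. \<Theta> $ i $ k * of_int (axis j 1 $ i) * of_int (m $ k))
        = (\<Sum>i\<in>UNIV. if i = j then \<Sum>k | k < i. ?t k else 0)"
      by (rule sum.cong) (auto simp: axis_def)
    then show ?thesis by simp
  qed
  have R: "(\<Sum>i\<in>UNIV. \<Sum>k | k < i. \<Theta> $ i $ k * of_int (m $ i) * of_int (axis j 1 $ k))
      = - (\<Sum>k | j < k. ?t k)"
  proof -
    have "(\<Sum>k | k < i. \<Theta> $ i $ k * of_int (m $ i) * of_int (axis j 1 $ k))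
        = (if j < i then - ?t i else 0)" for i
    proof -
      have "(\<Sum>k | k < i. \<Theta> $ i $ k * of_int (m $ i) * of_int (axis j 1 $ k))
          = (\<Sum>k | k < i. if k = j then - ?t i else 0)"
        by (rule sum.cong) (auto simp: axis_def sk [of i j])
      then show ?thesis by simp
    qed
    then have "(\<Sum>i\<in>UNIV. \<Sum>k | k < i. \<Theta> $ i $ k * of_int (m $ i) * of_int (axis j 1 $ k))
        = (\<Sum>i\<in>UNIV. if j < i then - ?t i else 0)" by simp
    also have "\<dots> = (\<Sum>k | j < k. - ?t k)"
      by (subst sum.If_cases) auto
    finally show ?thesis by (simp add: sum_negf)
  qed
  have "(UNIV :: 'n set) = {k. k < j} \<union> ({j} \<union> {k. j < k})" by auto
  then have "(\<Sum>k\<in>UNIV. ?t k) = (\<Sum>k\<in>{k. k < j} \<union> ({j} \<union> {k. j < k}). ?t k)"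
    by simp
  also have "\<dots> = (\<Sum>k | k < j. ?t k) + (\<Sum>k\<in>{j} \<union> {k. j < k}. ?t k)"
    by (rule sum.union_disjoint) auto
  also have "(\<Sum>k\<in>{j} \<union> {k. j < k}. ?t k) = ?t j + (\<Sum>k | j < k. ?t k)"
    by (subst sum.union_disjoint) auto
  finally have "(\<Sum>k\<in>UNIV. ?t k) = (\<Sum>k | k < j. ?t k) + (\<Sum>k | j < k. ?t k)"
    by (simp add: diag)
  then have "(\<Sum>k | k < j. ?t k) = (\<Sum>k\<in>UNIV. ?t k) + - (\<Sum>k | j < k. ?t k)" by simp
  then show ?thesis
    unfolding nct_phase_def twist_def L R cis_mult by (simp only: distrib_left)
qed

lemma nct_monom_axis_mult:
  assumes skew: "transpose \<Theta> = - \<Theta>"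
  shows "nct_mult \<Theta> (nct_monom (axis j 1)) a = nct_mult \<Theta> (nct_twist \<Theta> j a) (nct_monom (axis j 1))"
  by (rule smooth_torus_eqI) (simp add: fcoeff_monom_mult fcoeff_mult_monom nct_phase_axis [OF skew])

text \<open>Bracketing with U_j becomes the diagonal operator 1 - \<open>nct_twist\<close>, so inner
  derivations can be found by dividing coefficients.\<close>

lemma nct_ad_monom_axis:
  assumes skew: "transpose \<Theta> = - \<Theta>"
  shows "nct_ad \<Theta> b (nct_monom (axis j 1)) = nct_mult \<Theta> (b - nct_twist \<Theta> j b) (nct_monom (axis j 1))"
  by (simp add: nct_ad_def nct_monom_axis_mult [OF skew] nct.left_diff_distrib)

section \<open>Complex-linear derivations\<close>

text \<open>Unlike \<open>star_derivations\<close>, this set is closed under all complex scalars, so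
  normal forms with complex coefficients can be subtracted before their reality is
  discussed.\<close>

definition nct_derivations ::
  "'n theta \<Rightarrow> ('n::{finite,linorder} smooth_torus \<Rightarrow> 'n smooth_torus) set" where
  "nct_derivations \<Theta> = {\<delta>.
     (\<forall>a b. \<delta> (a + b) = \<delta> a + \<delta> b) \<and>
     (\<forall>z a. \<delta> (z *\<^sub>c a) = z *\<^sub>c \<delta> a) \<and>
     (\<forall>a b. \<delta> (nct_mult \<Theta> a b) = nct_mult \<Theta> (\<delta> a) b + nct_mult \<Theta> a (\<delta> b))}"

lemma star_derivations_iff:
  "\<delta> \<in> star_derivations \<Theta> \<longleftrightarrow>
     \<delta> \<in> nct_derivations \<Theta> \<and> (\<forall>a. \<delta> (nct_star \<Theta> a) = nct_star \<Theta> (\<delta> a))"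
  by (auto simp: star_derivations_def nct_derivations_def)

lemma nct_derivations_add: "\<delta> \<in> nct_derivations \<Theta> \<Longrightarrow> \<delta> (a + b) = \<delta> a + \<delta> b"
  and nct_derivations_cscale: "\<delta> \<in> nct_derivations \<Theta> \<Longrightarrow> \<delta> (z *\<^sub>c a) = z *\<^sub>c \<delta> a"
  and nct_derivations_mult:
    "\<delta> \<in> nct_derivations \<Theta> \<Longrightarrow> \<delta> (nct_mult \<Theta> a b) = nct_mult \<Theta> (\<delta> a) b + nct_mult \<Theta> a (\<delta> b)"
  by (auto simp: nct_derivations_def)

lemma nct_derivations_zero: "\<delta> \<in> nct_derivations \<Theta> \<Longrightarrow> \<delta> 0 = 0"
  using nct_derivations_cscale [of \<delta> \<Theta> 0 0] by simp

lemma nct_derivations_minus: "\<delta> \<in> nct_derivations \<Theta> \<Longrightarrow> \<delta> (- a) = - \<delta> a"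
  using nct_derivations_add [of \<delta> \<Theta> "- a" a] nct_derivations_zero [of \<delta> \<Theta>]
  by (simp add: eq_neg_iff_add_eq_0)

lemma nct_derivations_diff: "\<delta> \<in> nct_derivations \<Theta> \<Longrightarrow> \<delta> (a - b) = \<delta> a - \<delta> b"
  using nct_derivations_add [of \<delta> \<Theta> a "- b"] nct_derivations_minus [of \<delta> \<Theta> b] by simp

lemma nct_derivations_sum: "\<delta> \<in> nct_derivations \<Theta> \<Longrightarrow> \<delta> (sum f A) = (\<Sum>x\<in>A. \<delta> (f x))"
  by (induction A rule: infinite_finite_induct) (simp_all add: nct_derivations_zero nct_derivations_add)

lemma nct_derivations_one: "\<delta> \<in> nct_derivations \<Theta> \<Longrightarrow> \<delta> (nct_monom 0) = 0"
  using nct_derivations_mult [of \<delta> \<Theta> "nct_monom 0" "nct_monom 0"]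
  by (simp add: nct_mult_one_left nct_mult_one_right)

lemma nct_ad_derivation: "nct_ad \<Theta> b \<in> nct_derivations \<Theta>"
  unfolding nct_derivations_def nct_ad_def
  by (simp add: cscale_diff_right cscale_add_right
      nct_mult_add_left nct_mult_add_right nct.left_diff_distrib nct.right_diff_distrib nct_mult_assoc)

lemma nct_partial_derivation: "nct_partial j \<in> nct_derivations \<Theta>"
  using nct_partial_star_derivation star_derivations_iff by blast

lemma nct_derivations_plus:
  "\<delta> \<in> nct_derivations \<Theta> \<Longrightarrow> \<delta>' \<in> nct_derivations \<Theta> \<Longrightarrow> (\<lambda>a. \<delta> a + \<delta>' a) \<in> nct_derivations \<Theta>"
  by (simp add: nct_derivations_def cscale_add_right nct_mult_add_left nct_mult_add_right algebra_simps)

lemma nct_derivations_scale: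
  "\<delta> \<in> nct_derivations \<Theta> \<Longrightarrow> (\<lambda>a. z *\<^sub>c \<delta> a) \<in> nct_derivations \<Theta>"
  by (simp add: nct_derivations_def cscale_add_right cscale_cscale mult.commute)

text \<open>The normal form of a derivation. The pair (c, b) serves as coordinates once b is
  normalised to trace 0, since \<open>nct_ad\<close> ignores scalars.\<close>

definition outer_inner ::
  "'n theta \<Rightarrow> ('n \<Rightarrow> complex) \<Rightarrow> 'n smooth_torus \<Rightarrow> 'n::{finite,linorder} smooth_torus \<Rightarrow> 'n smooth_torus" where
  "outer_inner \<Theta> c b a = (\<Sum>j\<in>UNIV. c j *\<^sub>c nct_partial j a) + nct_ad \<Theta> b a"

lemma outer_inner_derivation: "outer_inner \<Theta> c b \<in> nct_derivations \<Theta>"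
proof -
  have "(\<lambda>a. \<Sum>j\<in>A. c j *\<^sub>c nct_partial j a) \<in> nct_derivations \<Theta>" for A :: "'a set"
  proof (induction A rule: infinite_finite_induct)
    case (insert x F)
    then show ?case
      using nct_derivations_plus [OF nct_derivations_scale [OF nct_partial_derivation] insert.IH] by simp
  qed (simp_all add: nct_derivations_def)
  from nct_derivations_plus [OF this nct_ad_derivation] show ?thesis
    unfolding outer_inner_def [abs_def] .
qed

section \<open>Derivations that vanish on the generators\<close>

text \<open>The exponents m for which U^m is killed form a subgroup of the lattice that contains all
  basis vectors.\<close>

lemma nct_derivation_monom_eq_0:
  fixes \<Theta> :: "'n::{finite,linorder} theta"
  assumes \<delta>: "\<delta> \<in> nct_derivations \<Theta>" and U: "\<And>j. \<delta> (nct_monom (axis j 1)) = 0"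
  shows "\<delta> (nct_monom m) = 0"
proof -
  define S where "S = {m. \<delta> (nct_monom m) = 0}"
  have add: "m + q \<in> S" if "m \<in> S" "q \<in> S" for m q
  proof -
    have "nct_monom (m + q) = inverse (nct_phase \<Theta> m q) *\<^sub>c nct_mult \<Theta> (nct_monom m) (nct_monom q)"
      by (simp add: nct_monom_mult cscale_cscale)
    then show ?thesis
      using that by (simp add: S_def nct_derivations_cscale [OF \<delta>] nct_derivations_mult [OF \<delta>])
  qed
  have zero: "0 \<in> S" by (simp add: S_def nct_derivations_one [OF \<delta>])
  have neg: "- m \<in> S" if "m \<in> S" for m
  proof -
    \<comment> \<open>The product of U^m and U^-m is a scalar, hence killed. Only the term with
      \<delta> on U^-m survives, and there U^m can be cancelled.\<close>
    have "nct_mult \<Theta> (nct_monom m) (nct_monom (- m)) = nct_phase \<Theta> m (- m) *\<^sub>c nct_monom 0"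
      by (simp add: nct_monom_mult)
    then have "nct_mult \<Theta> (nct_monom m) (\<delta> (nct_monom (- m))) = 0"
      using that nct_derivations_mult [OF \<delta>, of "nct_monom m" "nct_monom (- m)"]
      by (simp add: S_def nct_derivations_cscale [OF \<delta>] nct_derivations_one [OF \<delta>])
    then have "nct_mult \<Theta> (nct_star \<Theta> (nct_monom m)) (nct_mult \<Theta> (nct_monom m) (\<delta> (nct_monom (- m)))) = 0"
      by simp
    then show ?thesis
      by (simp add: S_def nct_mult_assoc [symmetric] nct_monom_star_left nct_mult_one_left)
  qed
  have "axis j (int n) \<in> S" for j n
  proof (induction n)
    case (Suc n)
    have "axis j (int (Suc n)) = axis j (int n) + axis j 1" by (auto simp: vec_eq_iff axis_def)
    then show ?case using add [OF Suc] U S_def by simp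
  qed (use zero in \<open>simp add: axis_def zero_vec_def\<close>)
  then have ax: "axis j i \<in> S" for j i
  proof (cases "i \<ge> 0")
    case False
    have "axis j i = - axis j (int (nat (- i)))" using False by (auto simp: vec_eq_iff axis_def)
    then show ?thesis using neg [OF \<open>axis j (int (nat (- i))) \<in> S\<close>] by simp
  qed (metis nonneg_int_cases)
  have sums: "(\<Sum>j\<in>A. axis j (m $ j)) \<in> S" for A :: "'n set"
    by (induction A rule: infinite_finite_induct) (auto intro: add zero ax)
  have "(\<Sum>j\<in>UNIV. axis j (m $ j)) = m"
    by (simp add: vec_eq_iff axis_def)
  then have "m \<in> S" using sums [of UNIV] by simp
  then show ?thesis by (simp add: S_def)
qed

text \<open>Apply \<delta> to the commutation relation that moves U_j past a, then cancel
  U_j.\<close>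

lemma nct_derivation_twist:
  assumes skew: "transpose \<Theta> = - \<Theta>"
    and \<delta>: "\<delta> \<in> nct_derivations \<Theta>" and U: "\<And>j. \<delta> (nct_monom (axis j 1)) = 0"
  shows "\<delta> (nct_twist \<Theta> j a) = nct_twist \<Theta> j (\<delta> a)"
proof (rule nct_mult_monom_cancel)
  have "nct_mult \<Theta> (\<delta> (nct_twist \<Theta> j a)) (nct_monom (axis j 1))
      = \<delta> (nct_mult \<Theta> (nct_twist \<Theta> j a) (nct_monom (axis j 1)))"
    by (simp add: nct_derivations_mult [OF \<delta>] U)
  also have "\<dots> = \<delta> (nct_mult \<Theta> (nct_monom (axis j 1)) a)"
    by (simp only: nct_monom_axis_mult [OF skew])
  also have "\<dots> = nct_mult \<Theta> (nct_monom (axis j 1)) (\<delta> a)"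
    by (simp add: nct_derivations_mult [OF \<delta>] U)
  finally show "nct_mult \<Theta> (\<delta> (nct_twist \<Theta> j a)) (nct_monom (axis j 1))
      = nct_mult \<Theta> (nct_twist \<Theta> j (\<delta> a)) (nct_monom (axis j 1))"
    by (simp only: nct_monom_axis_mult [OF skew])
qed

text \<open>\<open>J\<close> selects for each nonzero mode a unitary whose divisor is not small. The
  reciprocals then grow at most polynomially, which rapid decrease absorbs.\<close>

lemma generic_small_divisor:
  fixes \<Theta> :: "'n::finite theta"
  assumes "generically_transcendental \<Theta>"
  obtains J K N where "0 \<le> K"
    "\<And>m. m \<noteq> 0 \<Longrightarrow> twist \<Theta> (J m) m \<noteq> 1 \<and> inverse (cmod (1 - twist \<Theta> (J m) m)) \<le> K * (1 + lsize m) ^ N"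
proof -
  obtain C N where C: "0 < C"
    and ex: "\<forall>m :: int ^ 'n. m \<noteq> 0 \<longrightarrow> (\<exists>j. C / (1 + lsize m) ^ N \<le> cmod (twist \<Theta> j m - 1))"
    using assms unfolding generically_transcendental_def twist_def by blast
  then obtain J where J: "\<And>m. m \<noteq> 0 \<Longrightarrow> C / (1 + lsize m) ^ N \<le> cmod (twist \<Theta> (J m) m - 1)"
    by metis
  show thesis
  proof (rule that [of "inverse C" J N])
    fix m :: "int ^ 'n" assume "m \<noteq> 0"
    from J [OF this] have le: "C / (1 + lsize m) ^ N \<le> cmod (1 - twist \<Theta> (J m) m)"
      by (simp add: norm_minus_commute)
    have pos: "0 < C / (1 + lsize m) ^ N" using C by (simp add: add_pos_nonneg)
    have "twist \<Theta> (J m) m \<noteq> 1" using le pos by auto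
    moreover have "inverse (cmod (1 - twist \<Theta> (J m) m)) \<le> inverse C * (1 + lsize m) ^ N"
      using le_imp_inverse_le [OF le pos] by (simp add: divide_inverse mult.commute)
    ultimately show "twist \<Theta> (J m) m \<noteq> 1 \<and>
        inverse (cmod (1 - twist \<Theta> (J m) m)) \<le> inverse C * (1 + lsize m) ^ N" by simp
  qed (use C in simp)
qed

text \<open>\<open>R j\<close> inverts \<open>1 - nct_twist \<Theta> j\<close> on the modes assigned to \<open>j\<close> by \<open>J\<close>.\<close>

lemma generic_resolvent:
  fixes \<Theta> :: "'n::finite theta"
  assumes "generically_transcendental \<Theta>"
  obtains J and R :: "'n \<Rightarrow> 'n smooth_torus \<Rightarrow> 'n smooth_torus"
  where "\<And>m. m \<noteq> 0 \<Longrightarrow> twist \<Theta> (J m) m \<noteq> 1"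
    "\<And>j a m. fcoeff (R j a) m = (if m \<noteq> 0 \<and> J m = j then fcoeff a m / (1 - twist \<Theta> j m) else 0)"
proof -
  obtain J K N where K: "0 \<le> K" and J: "\<And>m. m \<noteq> 0 \<Longrightarrow> twist \<Theta> (J m) m \<noteq> 1 \<and>
      inverse (cmod (1 - twist \<Theta> (J m) m)) \<le> K * (1 + lsize m) ^ N"
    using generic_small_divisor [OF assms] by metis
  define r where "r j a m = (if m \<noteq> 0 \<and> J m = j then fcoeff a m / (1 - twist \<Theta> j m) else 0)" for j a m
  have "rapidly_decreasing (r j a)" for j a
  proof (rule rapidly_decreasing_dominated [where f = "\<lambda>m. m" and l = N and K = K and c = "fcoeff a"])
    fix m
    show "cmod (r j a m) \<le> K * (1 + lsize m) ^ N * cmod (fcoeff a m)"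
    proof (cases "m \<noteq> 0 \<and> J m = j")
      case True
      have "cmod (r j a m) = inverse (cmod (1 - twist \<Theta> j m)) * cmod (fcoeff a m)"
        using True by (simp add: r_def norm_divide field_simps)
      also have "\<dots> \<le> K * (1 + lsize m) ^ N * cmod (fcoeff a m)"
        using J [of m] True by (intro mult_right_mono) auto
      finally show ?thesis .
    qed (auto simp: r_def K)
  qed (use K in auto)
  then have "fcoeff (Abs_smooth_torus (r j a)) = r j a" for j a
    by (simp add: Abs_smooth_torus_inverse)
  then show thesis
    using that [of J "\<lambda>j a. Abs_smooth_torus (r j a)"] J by (simp add: r_def)
qed

text \<open>No continuity of \<delta> is assumed, so vanishing on the U^m does not extend to series
  by a limit. Instead every coefficient of a value of \<delta> is, up to a phase, the zero mode of
  another value, and these zero modes vanish.\<close>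

lemma nct_derivation_eq_0:
  fixes \<Theta> :: "'n::{finite,linorder} theta"
  assumes skew: "transpose \<Theta> = - \<Theta>" and generic: "generically_transcendental \<Theta>"
    and \<delta>: "\<delta> \<in> nct_derivations \<Theta>" and U: "\<And>j. \<delta> (nct_monom (axis j 1)) = 0"
  shows "\<delta> a = 0"
proof -
  obtain J R where J: "\<And>m. m \<noteq> 0 \<Longrightarrow> twist \<Theta> (J m) m \<noteq> 1"
    and R: "\<And>j a m. fcoeff (R j a :: 'n smooth_torus) m
      = (if m \<noteq> 0 \<and> J m = j then fcoeff a m / (1 - twist \<Theta> j m) else 0)"
    using generic_resolvent [OF generic] by metis
  \<comment> \<open>At a nonzero mode only j = \<open>J m\<close> contributes, and there
    \<open>R j\<close> undoes 1 - \<open>nct_twist\<close>.\<close>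
  have coboundary: "a = fcoeff a 0 *\<^sub>c nct_monom 0 + (\<Sum>j\<in>UNIV. R j a - nct_twist \<Theta> j (R j a))" for a
  proof (rule smooth_torus_eqI)
    fix m
    have "(\<Sum>j\<in>UNIV. fcoeff (R j a) m - twist \<Theta> j m * fcoeff (R j a) m)
        = (\<Sum>j\<in>UNIV. if j = J m then (if m \<noteq> 0 then fcoeff a m else 0) else 0)"
      using J [of m] by (intro sum.cong) (auto simp: R field_simps)
    then show "fcoeff a m = fcoeff (fcoeff a 0 *\<^sub>c nct_monom 0 + (\<Sum>j\<in>UNIV. R j a - nct_twist \<Theta> j (R j a))) m"
      by (auto simp: fcoeff_monom)
  qed
  \<comment> \<open>The scalar part is killed. Since \<delta> commutes with
    \<open>nct_twist\<close>, whose eigenvalue at mode 0 is 1, each difference has zero mode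
    0.\<close>
  have trace: "fcoeff (\<delta> a) 0 = 0" for a
    by (subst coboundary [of a])
      (simp add: nct_derivations_add [OF \<delta>] nct_derivations_cscale [OF \<delta>] nct_derivations_one [OF \<delta>]
        nct_derivations_sum [OF \<delta>] nct_derivations_diff [OF \<delta>] nct_derivation_twist [OF skew \<delta> U])
  show ?thesis
  proof (rule smooth_torus_eqI)
    fix m
    \<comment> \<open>Multiplication by U^-m moves mode m to mode 0, up to a nonzero phase.\<close>
    have "\<delta> (nct_mult \<Theta> (nct_monom (- m)) a) = nct_mult \<Theta> (nct_monom (- m)) (\<delta> a)"
      by (simp add: nct_derivations_mult [OF \<delta>] nct_derivation_monom_eq_0 [OF \<delta> U])
    then have "fcoeff (nct_mult \<Theta> (nct_monom (- m)) (\<delta> a)) 0 = 0" by (metis trace)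
    then show "fcoeff (\<delta> a) m = fcoeff 0 m" by (simp add: fcoeff_monom_mult)
  qed
qed

section \<open>Decomposition into outer and inner parts\<close>

text \<open>In the factor in front of U_j, the outer part occupies the zero mode and the inner part
  the nonzero modes, so c and b can be read off separately.\<close>

lemma outer_inner_monom_axis:
  assumes skew: "transpose \<Theta> = - \<Theta>"
  shows "outer_inner \<Theta> c b (nct_monom (axis j 1))
    = nct_mult \<Theta> ((2 * of_real pi * \<i> * c j) *\<^sub>c nct_monom 0 + (b - nct_twist \<Theta> j b)) (nct_monom (axis j 1))"
proof -
  have "nct_partial k (nct_monom (axis j 1)) = (if k = j then 2 * of_real pi * \<i> else 0) *\<^sub>c nct_monom (axis j 1)" for k :: 'a
    by (rule smooth_torus_eqI) (auto simp: fcoeff_monom axis_def)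
  then have "(\<Sum>k\<in>UNIV. c k *\<^sub>c nct_partial k (nct_monom (axis j 1)))
      = (\<Sum>k\<in>UNIV. if k = j then (2 * of_real pi * \<i> * c j) *\<^sub>c nct_monom (axis j 1) else 0)"
    by (intro sum.cong) (auto simp: cscale_cscale mult_ac)
  then show ?thesis
    by (simp add: outer_inner_def nct_ad_monom_axis [OF skew] nct_mult_add_left nct_mult_one_left)
qed

text \<open>It suffices to match \<delta> on the generators. Writing each value as h_j times U_j, a
  single b has to solve b - \<open>nct_twist\<close> b = h_j off the zero mode for all j at once;
  the commutation relations make these equations compatible.\<close>

theorem nct_derivation_decomposition:
  fixes \<Theta> :: "'n::{finite,linorder} theta"
  assumes skew: "transpose \<Theta> = - \<Theta>" and generic: "generically_transcendental \<Theta>"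
    and \<delta>: "\<delta> \<in> nct_derivations \<Theta>"
  obtains c b where "nct_trace b = 0" "\<delta> = outer_inner \<Theta> c b"
proof -
  let ?U = "\<lambda>j. nct_monom (axis j 1) :: 'n smooth_torus"
  obtain J R where J: "\<And>m. m \<noteq> 0 \<Longrightarrow> twist \<Theta> (J m) m \<noteq> 1"
    and R: "\<And>j a m. fcoeff (R j a :: 'n smooth_torus) m
      = (if m \<noteq> 0 \<and> J m = j then fcoeff a m / (1 - twist \<Theta> j m) else 0)"
    using generic_resolvent [OF generic] by metis
  define h where "h j = nct_mult \<Theta> (\<delta> (?U j)) (nct_star \<Theta> (?U j))" for j
  have \<delta>U: "\<delta> (?U j) = nct_mult \<Theta> (h j) (?U j)" for j
    by (simp add: h_def nct_mult_assoc nct_monom_star_left nct_mult_one_right)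
  have \<delta>UU: "\<delta> (nct_mult \<Theta> (?U j) (?U k))
      = nct_mult \<Theta> (h j + nct_twist \<Theta> j (h k)) (nct_mult \<Theta> (?U j) (?U k))" for j k
  proof -
    have "nct_mult \<Theta> (?U j) (nct_mult \<Theta> (h k) (?U k))
        = nct_mult \<Theta> (nct_twist \<Theta> j (h k)) (nct_mult \<Theta> (?U j) (?U k))"
      by (simp only: nct_mult_assoc [symmetric] nct_monom_axis_mult [OF skew, of j "h k"])
    then show ?thesis
      by (simp add: nct_derivations_mult [OF \<delta>] \<delta>U nct_mult_add_left nct_mult_assoc)
  qed
  \<comment> \<open>The integrability condition, obtained by applying \<delta> to the relation
    between U_j and U_k.\<close>
  have sym: "h j + nct_twist \<Theta> j (h k) = h k + nct_twist \<Theta> k (h j)" for j k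
  proof -
    define z where "z = nct_phase \<Theta> (axis j 1) (axis k 1) / nct_phase \<Theta> (axis k 1) (axis j 1)"
    have UU: "nct_mult \<Theta> (?U j) (?U k) = z *\<^sub>c nct_mult \<Theta> (?U k) (?U j)"
      by (simp add: nct_monom_mult cscale_cscale z_def add.commute)
    have "nct_mult \<Theta> (h j + nct_twist \<Theta> j (h k)) (nct_mult \<Theta> (?U j) (?U k))
        = \<delta> (nct_mult \<Theta> (?U j) (?U k))"
      by (rule \<delta>UU [symmetric])
    also have "\<dots> = z *\<^sub>c \<delta> (nct_mult \<Theta> (?U k) (?U j))"
      by (simp only: UU nct_derivations_cscale [OF \<delta>])
    also have "\<dots> = nct_mult \<Theta> (h k + nct_twist \<Theta> k (h j)) (nct_mult \<Theta> (?U j) (?U k))"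
      by (simp only: \<delta>UU UU nct_mult_cscale_right)
    finally have "nct_mult \<Theta> (h j + nct_twist \<Theta> j (h k)) (nct_monom (axis j 1 + axis k 1))
        = nct_mult \<Theta> (h k + nct_twist \<Theta> k (h j)) (nct_monom (axis j 1 + axis k 1))"
      by (auto simp: nct_monom_mult dest: arg_cong [where f = "\<lambda>a. inverse (nct_phase \<Theta> (axis j 1) (axis k 1)) *\<^sub>c a"]
          simp: cscale_cscale)
    then show ?thesis by (rule nct_mult_monom_cancel)
  qed
  have coeff_sym: "(1 - twist \<Theta> k m) * fcoeff (h j) m = (1 - twist \<Theta> j m) * fcoeff (h k) m" for j k m
    using arg_cong [OF sym [of j k], of "\<lambda>a. fcoeff a m"] by (simp add: algebra_simps)
  \<comment> \<open>At each nonzero mode m this solves the equation for the index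
    \<open>J m\<close>; its zero mode is 0.\<close>
  define b where "b = (\<Sum>j\<in>UNIV. R j (h j))"
  \<comment> \<open>The zero mode of h_j, divided by the eigenvalue of the j-th generator on
    U_j.\<close>
  define c where "c j = fcoeff (h j) 0 / (2 * of_real pi * \<i>)" for j
  have b: "fcoeff b m = (if m = 0 then 0 else fcoeff (h (J m)) m / (1 - twist \<Theta> (J m) m))" for m
  proof -
    have "fcoeff b m = (\<Sum>j\<in>UNIV. if j = J m then (if m = 0 then 0 else fcoeff (h j) m / (1 - twist \<Theta> j m)) else 0)"
      unfolding b_def fcoeff_sum by (intro sum.cong) (auto simp: R)
    then show ?thesis by simp
  qed
  have h: "(2 * of_real pi * \<i> * c j) *\<^sub>c nct_monom 0 + (b - nct_twist \<Theta> j b) = h j" for j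
  proof (rule smooth_torus_eqI)
    fix m
    show "fcoeff ((2 * of_real pi * \<i> * c j) *\<^sub>c nct_monom 0 + (b - nct_twist \<Theta> j b)) m = fcoeff (h j) m"
    proof (cases "m = 0")
      case False
      then have "1 - twist \<Theta> (J m) m \<noteq> 0" using J [of m] by simp
      \<comment> \<open>\<open>coeff_sym\<close> carries the equation from the index
        \<open>J m\<close> over to every j.\<close>
      then have "(1 - twist \<Theta> j m) * fcoeff b m = fcoeff (h j) m"
        using coeff_sym [of "J m" m j] False by (simp add: b field_simps)
      then show ?thesis using False by (simp add: fcoeff_monom algebra_simps)
    qed (simp add: fcoeff_monom b c_def)
  qed
  have "(\<lambda>a. \<delta> a + (- 1) *\<^sub>c outer_inner \<Theta> c b a) \<in> nct_derivations \<Theta>"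
    by (intro nct_derivations_plus nct_derivations_scale \<delta> outer_inner_derivation)
  then have "\<delta> a + (- 1) *\<^sub>c outer_inner \<Theta> c b a = 0" for a
  proof (rule nct_derivation_eq_0 [OF skew generic])
    fix j show "\<delta> (?U j) + (- 1) *\<^sub>c outer_inner \<Theta> c b (?U j) = 0"
      unfolding outer_inner_monom_axis [OF skew] h \<delta>U by (rule smooth_torus_eqI) simp
  qed
  then have "\<delta> a = outer_inner \<Theta> c b a" for a
    by (metis (no_types, opaque_lifting) add_right_cancel cscale_add_left cscale_one
        cscale_zero_left add.right_inverse add.commute)
  moreover have "nct_trace b = 0" by (simp add: nct_trace_def b)
  ultimately show thesis using that by blast
qed

text \<open>Compare values on the generators: mode 0 gives c, a nonvanishing divisor gives each
  other coefficient of b, and the trace condition fixes the remaining scalar.\<close>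

lemma outer_inner_unique:
  fixes \<Theta> :: "'n::{finite,linorder} theta"
  assumes skew: "transpose \<Theta> = - \<Theta>" and generic: "generically_transcendental \<Theta>"
    and b: "nct_trace b = 0" "nct_trace b' = 0" and eq: "outer_inner \<Theta> c b = outer_inner \<Theta> c' b'"
  shows "c = c' \<and> b = b'"
proof -
  have "(2 * of_real pi * \<i> * c j) *\<^sub>c nct_monom 0 + (b - nct_twist \<Theta> j b)
      = (2 * of_real pi * \<i> * c' j) *\<^sub>c nct_monom 0 + (b' - nct_twist \<Theta> j b')" for j
    by (rule nct_mult_monom_cancel [of \<Theta> _ "axis j 1"])
      (simp only: outer_inner_monom_axis [OF skew, symmetric] eq)
  then have coeff: "2 * of_real pi * \<i> * c j * (if m = 0 then 1 else 0) + (1 - twist \<Theta> j m) * fcoeff b m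
      = 2 * of_real pi * \<i> * c' j * (if m = 0 then 1 else 0) + (1 - twist \<Theta> j m) * fcoeff b' m" for j m
    by (drule_tac x = j in meta_spec, drule_tac f = "\<lambda>a. fcoeff a m" in arg_cong)
      (simp add: fcoeff_monom algebra_simps)
  have "c j = c' j" for j using coeff [of j 0] by simp
  moreover have "fcoeff b m = fcoeff b' m" for m
  proof (cases "m = 0")
    case False
    obtain J where "twist \<Theta> (J m) m \<noteq> 1" using generic_small_divisor [OF generic] False by metis
    then show ?thesis using coeff [of "J m" m] False by simp
  qed (use b in \<open>simp add: nct_trace_def\<close>)
  ultimately show ?thesis by (auto intro: smooth_torus_eqI)
qed

section \<open>Reality conditions for *-derivations\<close>

text \<open>The partial derivations commute with the star, which reverses commutators. The
  *-derivations are the fixed points of this action on normal forms.\<close>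

lemma outer_inner_star:
  "nct_star \<Theta> (outer_inner \<Theta> c b (nct_star \<Theta> a)) = outer_inner \<Theta> (\<lambda>j. cnj (c j)) (- nct_star \<Theta> b) a"
proof -
  have sum: "nct_star \<Theta> (sum f A) = (\<Sum>x\<in>A. nct_star \<Theta> (f x))" for f and A :: "'a set"
    by (induction A rule: infinite_finite_induct) (auto simp: nct_star_add)
  have "nct_star \<Theta> (nct_partial j (nct_star \<Theta> a)) = nct_partial j a" for j
    using nct_partial_star_derivation [of j \<Theta>] by (simp add: star_derivations_iff)
  then show ?thesis
    by (simp add: outer_inner_def nct_star_add sum nct_star_cscale nct_ad_def nct_star_diff
        nct_star_mult nct.minus_mult_left [symmetric] nct.minus_mult_right [symmetric])
qed

text \<open>By uniqueness of coordinates, a fixed point under conjugation by the star is one whose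
  pair (c, b) is fixed.\<close>

lemma outer_inner_star_derivation_iff:
  fixes \<Theta> :: "'n::{finite,linorder} theta"
  assumes skew: "transpose \<Theta> = - \<Theta>" and generic: "generically_transcendental \<Theta>"
    and b: "nct_trace b = 0"
  shows "outer_inner \<Theta> c b \<in> star_derivations \<Theta> \<longleftrightarrow> (\<forall>j. cnj (c j) = c j) \<and> nct_star \<Theta> b = - b"
proof
  assume "outer_inner \<Theta> c b \<in> star_derivations \<Theta>"
  then have "outer_inner \<Theta> (\<lambda>j. cnj (c j)) (- nct_star \<Theta> b) a = outer_inner \<Theta> c b a" for a
    unfolding outer_inner_star [symmetric] by (simp add: star_derivations_iff)
  then have "(\<lambda>j. cnj (c j)) = c \<and> - nct_star \<Theta> b = b"
    by (intro outer_inner_unique [OF skew generic]) (use b in \<open>auto simp: nct_trace_def fcoeff_star\<close>)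
  then show "(\<forall>j. cnj (c j) = c j) \<and> nct_star \<Theta> b = - b" by (metis minus_equation_iff)
next
  assume *: "(\<forall>j. cnj (c j) = c j) \<and> nct_star \<Theta> b = - b"
  then have "nct_star \<Theta> (outer_inner \<Theta> c b (nct_star \<Theta> a)) = outer_inner \<Theta> c b a" for a
    by (simp add: outer_inner_star)
  then show "outer_inner \<Theta> c b \<in> star_derivations \<Theta>"
    unfolding star_derivations_iff by (metis outer_inner_derivation nct_star_star)
qed

section \<open>Metrics and connections\<close>

lemma vf_mult_component [simp]: "vf_mult \<Theta> a X $ k = nct_mult \<Theta> a (X $ k)"
  by (simp add: vf_mult_def)

lemma vf_cscale_component [simp]: "vf_cscale z X $ k = z *\<^sub>c (X $ k)"
  by (simp add: vf_cscale_def)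

lemma vf_partial_component: "vf_partial j $ k = (if k = j then nct_monom 0 else 0)"
  by (simp add: vf_partial_def axis_def)

lemma vf_mult_add_left: "vf_mult \<Theta> (a + b) X = vf_mult \<Theta> a X + vf_mult \<Theta> b X"
  and vf_mult_add_right: "vf_mult \<Theta> a (X + Y) = vf_mult \<Theta> a X + vf_mult \<Theta> a Y"
  and vf_mult_vf_mult: "vf_mult \<Theta> a (vf_mult \<Theta> b X) = vf_mult \<Theta> (nct_mult \<Theta> a b) X"
  and vf_mult_one [simp]: "vf_mult \<Theta> (nct_monom 0) X = X"
  and vf_mult_zero_left [simp]: "vf_mult \<Theta> 0 X = 0"
  and vf_mult_zero_right [simp]: "vf_mult \<Theta> a 0 = 0"
  and vf_mult_cscale_left: "vf_mult \<Theta> (z *\<^sub>c a) X = vf_cscale z (vf_mult \<Theta> a X)"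
  and vf_mult_cscale_right: "vf_mult \<Theta> a (vf_cscale z X) = vf_cscale z (vf_mult \<Theta> a X)"
  by (simp_all add: vec_eq_iff nct_mult_add_left nct_mult_add_right nct_mult_assoc
      nct_mult_one_left)

lemma vf_cscale_add_right: "vf_cscale z (X + Y) = vf_cscale z X + vf_cscale z Y"
  and vf_cscale_add_left: "vf_cscale (z + w) X = vf_cscale z X + vf_cscale w X"
  and vf_cscale_cscale: "vf_cscale z (vf_cscale w X) = vf_cscale (z * w) X"
  and vf_cscale_one [simp]: "vf_cscale 1 X = X"
  and vf_cscale_zero_left [simp]: "vf_cscale 0 X = 0"
  and vf_cscale_zero_right [simp]: "vf_cscale z 0 = 0"
  by (simp_all add: vec_eq_iff cscale_add_right cscale_add_left cscale_cscale)

lemma vf_mult_sum_right: "vf_mult \<Theta> a (sum f A) = (\<Sum>x\<in>A. vf_mult \<Theta> a (f x))"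
  by (induction A rule: infinite_finite_induct) (simp_all add: vf_mult_add_right)

lemma vf_cscale_sum_right: "vf_cscale z (sum f A) = (\<Sum>x\<in>A. vf_cscale z (f x))"
  by (induction A rule: infinite_finite_induct) (simp_all add: vf_cscale_add_right)

lemma vf_expand: "(\<Sum>k\<in>UNIV. vf_mult \<Theta> (X $ k) (vf_partial k)) = X"
proof -
  have "(\<Sum>k\<in>UNIV. nct_mult \<Theta> (X $ k) (vf_partial k $ l)) = (\<Sum>k\<in>UNIV. if k = l then X $ k else 0)" for l
    by (intro sum.cong) (auto simp: vf_partial_component nct_mult_one_right)
  then show ?thesis by (simp add: vec_eq_iff)
qed

section \<open>Calculus of a metric\<close>

locale nct_metric =
  fixes \<Theta> :: "'n::{finite,linorder} theta"
    and g :: "'n vfield \<Rightarrow> 'n vfield \<Rightarrow> 'n smooth_torus"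
  assumes metric: "riemannian_metric \<Theta> g"
begin

lemma g_add_right: "g X (Y + Y') = g X Y + g X Y'"
  using metric [unfolded riemannian_metric_def, THEN conjunct1] by simp

lemma g_cscale_left: "g (vf_cscale z X) Y = z *\<^sub>c g X Y"
  and g_cscale_right: "g X (vf_cscale z Y) = cnj z *\<^sub>c g X Y"
  using metric [unfolded riemannian_metric_def, THEN conjunct2, THEN conjunct1] by simp_all

lemma g_add_left: "g (X + X') Y = g X Y + g X' Y"
  using metric [unfolded riemannian_metric_def, THEN conjunct2, THEN conjunct2, THEN conjunct1] by simp

lemma g_mult_left: "g (vf_mult \<Theta> a X) Y = nct_mult \<Theta> a (g X Y)"
  using metric [unfolded riemannian_metric_def, THEN conjunct2, THEN conjunct2, THEN conjunct2,
      THEN conjunct1] by simp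

lemma star_g: "nct_star \<Theta> (g X Y) = g Y X"
  using metric [unfolded riemannian_metric_def, THEN conjunct2, THEN conjunct2, THEN conjunct2,
      THEN conjunct2, THEN conjunct1] by simp

lemma g_definite: "g X X = 0 \<Longrightarrow> X = 0"
  using metric [unfolded riemannian_metric_def, THEN conjunct2, THEN conjunct2, THEN conjunct2,
      THEN conjunct2, THEN conjunct2, THEN conjunct1] by blast

lemma star_g_partial: "nct_star \<Theta> (g (vf_partial j) (vf_partial k)) = g (vf_partial j) (vf_partial k)"
  using metric [unfolded riemannian_metric_def, THEN conjunct2, THEN conjunct2, THEN conjunct2,
      THEN conjunct2, THEN conjunct2, THEN conjunct2] by blast

lemma g_mult_right: "g X (vf_mult \<Theta> a Y) = nct_mult \<Theta> (g X Y) (nct_star \<Theta> a)"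
  by (subst star_g [symmetric]) (simp add: g_mult_left nct_star_mult star_g)

lemma g_zero_left [simp]: "g 0 Y = 0"
  using g_cscale_left [of 0 0] by simp

lemma g_zero_right [simp]: "g X 0 = 0"
  using g_cscale_right [of X 0 0] by simp

lemma g_sum_left: "g (sum f A) Y = (\<Sum>x\<in>A. g (f x) Y)"
  by (induction A rule: infinite_finite_induct) (simp_all add: g_add_left)

lemma g_sum_right: "g X (sum f A) = (\<Sum>x\<in>A. g X (f x))"
  by (induction A rule: infinite_finite_induct) (simp_all add: g_add_right)

lemma g_diff_left: "g (X - X') Y = g X Y - g X' Y"
  using g_add_left [of "X - X'" X' Y] by simp

lemma g_partial_sym: "g (vf_partial j) (vf_partial k) = g (vf_partial k) (vf_partial j)"
  by (metis star_g star_g_partial)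

text \<open>The difference is orthogonal to the basis, hence to itself, and definiteness
  applies.\<close>

lemma vf_eqI:
  assumes "\<And>l. g X (vf_partial l) = g Y (vf_partial l)"
  shows "X = Y"
proof -
  let ?Z = "X - Y"
  have "g ?Z ?Z = g ?Z (\<Sum>l\<in>UNIV. vf_mult \<Theta> (?Z $ l) (vf_partial l))"
    by (simp only: vf_expand)
  also have "\<dots> = 0"
    by (simp only: g_sum_right g_mult_right g_diff_left assms) simp
  finally show ?thesis using g_definite [of ?Z] by simp
qed

text \<open>\<open>E\<close> stands for the covariant derivative along \<delta>. Both sides obey the
  same Leibniz rule in the coefficients; those of the second slot enter through their adjoints, so
  \<delta> must commute with the star.\<close>

lemma compatible_if_on_basis:
  assumes \<delta>: "\<delta> \<in> star_derivations \<Theta>"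
    and add: "\<And>X Y. E (X + Y) = E X + E Y"
    and leibniz: "\<And>a X. E (vf_mult \<Theta> a X) = vf_mult \<Theta> (\<delta> a) X + vf_mult \<Theta> a (E X)"
    and basis: "\<And>k l. \<delta> (g (vf_partial k) (vf_partial l))
      = g (E (vf_partial k)) (vf_partial l) + g (vf_partial k) (E (vf_partial l))"
  shows "\<delta> (g X Y) = g (E X) Y + g X (E Y)"
proof -
  have d: "\<delta> \<in> nct_derivations \<Theta>" and s: "\<delta> (nct_star \<Theta> a) = nct_star \<Theta> (\<delta> a)" for a
    using \<delta> by (auto simp: star_derivations_iff)
  have E0: "E 0 = 0" using add [of 0 0] by simp
  have Esum: "E (sum f A) = (\<Sum>x\<in>A. E (f x))" for f and A :: "'n set"
    by (induction A rule: infinite_finite_induct) (simp_all add: E0 add)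
  have 1: "\<delta> (g (vf_mult \<Theta> a (vf_partial k)) (vf_mult \<Theta> b (vf_partial l)))
      = g (E (vf_mult \<Theta> a (vf_partial k))) (vf_mult \<Theta> b (vf_partial l))
        + g (vf_mult \<Theta> a (vf_partial k)) (E (vf_mult \<Theta> b (vf_partial l)))" for a b k l
    by (simp add: leibniz g_mult_left g_mult_right g_add_left g_add_right nct_derivations_mult [OF d] basis s
        nct_mult_add_left nct_mult_add_right nct_mult_assoc add_ac)
  let ?x = "\<lambda>k. vf_mult \<Theta> (X $ k) (vf_partial k)" and ?y = "\<lambda>l. vf_mult \<Theta> (Y $ l) (vf_partial l)"
  have "\<delta> (g (\<Sum>k\<in>UNIV. ?x k) (\<Sum>l\<in>UNIV. ?y l))
      = g (E (\<Sum>k\<in>UNIV. ?x k)) (\<Sum>l\<in>UNIV. ?y l) + g (\<Sum>k\<in>UNIV. ?x k) (E (\<Sum>l\<in>UNIV. ?y l))"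
    by (simp add: Esum g_sum_left g_sum_right nct_derivations_sum [OF d] 1 sum.distrib)
  then show ?thesis by (simp only: vf_expand)
qed

text \<open>The Koszul expression for coordinate fields; bracket terms are absent because the
  partial derivations commute.\<close>

definition koszul :: "'n \<Rightarrow> 'n \<Rightarrow> 'n \<Rightarrow> 'n smooth_torus" where
  "koszul j k l = (1 / 2) *\<^sub>c
     (nct_partial j (g (vf_partial k) (vf_partial l)) +
      nct_partial k (g (vf_partial j) (vf_partial l)) -
      nct_partial l (g (vf_partial j) (vf_partial k)))"

lemma star_koszul: "nct_star \<Theta> (koszul j k l) = koszul j k l"
proof -
  have "nct_star \<Theta> (nct_partial i a) = nct_partial i (nct_star \<Theta> a)" for i a
    using nct_partial_star_derivation [of i \<Theta>] by (simp add: star_derivations_iff)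
  then show ?thesis
    by (simp add: koszul_def nct_star_cscale nct_star_add nct_star_diff star_g_partial)
qed

end

section \<open>Connections evaluated on normal forms\<close>

lemma star_derivations_plus:
  "\<delta> \<in> star_derivations \<Theta> \<Longrightarrow> \<delta>' \<in> star_derivations \<Theta> \<Longrightarrow> (\<lambda>a. \<delta> a + \<delta>' a) \<in> star_derivations \<Theta>"
  by (simp add: star_derivations_iff nct_derivations_plus nct_star_add)

lemma star_derivations_scale:
  "\<delta> \<in> star_derivations \<Theta> \<Longrightarrow> cnj z = z \<Longrightarrow> (\<lambda>a. z *\<^sub>c \<delta> a) \<in> star_derivations \<Theta>"
  by (simp add: star_derivations_iff nct_derivations_scale nct_star_cscale)

lemma star_derivations_zero: "(\<lambda>a. 0) \<in> star_derivations \<Theta>"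
  by (simp add: star_derivations_def)

locale nct_connection = nct_metric \<Theta> g
  for \<Theta> :: "'n::{finite,linorder} theta" and g +
  fixes D :: "('n smooth_torus \<Rightarrow> 'n smooth_torus) \<Rightarrow> 'n vfield \<Rightarrow> 'n vfield"
  assumes skew: "transpose \<Theta> = - \<Theta>" and generic: "generically_transcendental \<Theta>"
    and connection: "connection \<Theta> g D"
begin

text \<open>The scalar is taken real so that the multiple is again a *-derivation.\<close>

lemma D_scale: "\<delta> \<in> star_derivations \<Theta> \<Longrightarrow> cnj z = z \<Longrightarrow> D (\<lambda>a. z *\<^sub>c \<delta> a) Y = vf_cscale z (D \<delta> Y)"
  and D_plus: "\<delta> \<in> star_derivations \<Theta> \<Longrightarrow> \<delta>' \<in> star_derivations \<Theta> \<Longrightarrow>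
    D (\<lambda>a. \<delta> a + \<delta>' a) Y = D \<delta> Y + D \<delta>' Y"
  and D_add: "\<delta> \<in> star_derivations \<Theta> \<Longrightarrow> D \<delta> (Y + Y') = D \<delta> Y + D \<delta> Y'"
  and D_leibniz: "\<delta> \<in> star_derivations \<Theta> \<Longrightarrow>
    D \<delta> (vf_mult \<Theta> a Y) = vf_mult \<Theta> (\<delta> a) Y + vf_mult \<Theta> a (D \<delta> Y)"
  and D_ad: "nct_trace a = 0 \<Longrightarrow> nct_ad \<Theta> a \<in> star_derivations \<Theta> \<Longrightarrow> D (nct_ad \<Theta> a) Y = vf_mult \<Theta> a Y"
  and D_self_adjoint: "nct_star \<Theta> (g (D (nct_partial j) (vf_partial k)) (vf_partial l))
        = g (D (nct_partial j) (vf_partial k)) (vf_partial l)"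
  and D_extensional: "D \<in> extensional (star_derivations \<Theta>)"
  using connection star_derivations_scale [of \<delta> \<Theta> z] unfolding connection_def by simp_all

lemma D_sum:
  assumes "\<delta> \<in> star_derivations \<Theta>"
  shows "D \<delta> (sum f A) = (\<Sum>x\<in>A. D \<delta> (f x))"
proof -
  have "D \<delta> 0 = 0" using D_add [OF assms, of 0 0] by simp
  then show ?thesis
    by (induction A rule: infinite_finite_induct) (simp_all add: D_add [OF assms])
qed

text \<open>Linearity handles the outer part, the axiom on inner derivations the rest. The induction
  also records that each partial sum is a *-derivation, since the axioms speak of those.\<close>

lemma D_outer_inner:
  assumes c: "\<And>j. cnj (c j) = c j" and b: "nct_star \<Theta> b = - b" "nct_trace b = 0"
  shows "D (outer_inner \<Theta> c b) Y = (\<Sum>j\<in>UNIV. vf_cscale (c j) (D (nct_partial j) Y)) + vf_mult \<Theta> b Y"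
proof -
  have D0: "D (\<lambda>a. 0) Y = 0"
    using D_plus [OF star_derivations_zero star_derivations_zero, of Y] by simp
  have "(\<lambda>a. \<Sum>j\<in>A. c j *\<^sub>c nct_partial j a) \<in> star_derivations \<Theta> \<and>
      D (\<lambda>a. \<Sum>j\<in>A. c j *\<^sub>c nct_partial j a) Y = (\<Sum>j\<in>A. vf_cscale (c j) (D (nct_partial j) Y))"
    for A :: "'n set"
  proof (induction A rule: infinite_finite_induct)
    case (insert x F)
    note 1 = star_derivations_scale [OF nct_partial_star_derivation c, of x x]
    from insert.IH have F: "(\<lambda>a. \<Sum>j\<in>F. c j *\<^sub>c nct_partial j a) \<in> star_derivations \<Theta>" by blast
    show ?case
      using insert star_derivations_plus [OF 1 F] D_plus [OF 1 F, of Y]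
        D_scale [OF nct_partial_star_derivation c, of x x Y]
      by simp
  qed (simp_all add: star_derivations_zero D0)
  then have s: "(\<lambda>a. \<Sum>j\<in>UNIV. c j *\<^sub>c nct_partial j a) \<in> star_derivations \<Theta>"
    and Ds: "D (\<lambda>a. \<Sum>j\<in>UNIV. c j *\<^sub>c nct_partial j a) Y = (\<Sum>j\<in>UNIV. vf_cscale (c j) (D (nct_partial j) Y))"
    by blast+
  \<comment> \<open>The reality criterion with c = 0 shows that the inner part is a *-derivation by
    itself.\<close>
  have "outer_inner \<Theta> (\<lambda>j. 0) b \<in> star_derivations \<Theta>"
    using outer_inner_star_derivation_iff [OF skew generic b(2)] b(1) by simp
  then have ad: "nct_ad \<Theta> b \<in> star_derivations \<Theta>"
    unfolding outer_inner_def [abs_def] by simp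
  show ?thesis
    using D_plus [OF s ad, of Y] unfolding outer_inner_def [abs_def] Ds D_ad [OF b(2) ad] .
qed

lemma D_decompose:
  assumes "\<delta> \<in> star_derivations \<Theta>"
  obtains c b where "\<And>j. cnj (c j) = c j" "nct_star \<Theta> b = - b" "nct_trace b = 0" "\<delta> = outer_inner \<Theta> c b"
proof -
  obtain c b where "nct_trace b = 0" "\<delta> = outer_inner \<Theta> c b"
    using nct_derivation_decomposition [OF skew generic] assms star_derivations_iff by metis
  then show thesis
    using that [of c b] assms outer_inner_star_derivation_iff [OF skew generic, of b c] by simp
qed

text \<open>Self-adjointness of the products plays the part of the symmetry of a real metric in the
  classical argument. Conversely, compatibility on coordinate fields spreads to all fields by
  Leibniz and to all \<delta> by the normal form.\<close>

lemma levi_civita_iff_koszul: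
  "levi_civita \<Theta> g D \<longleftrightarrow> (\<forall>j k l. g (D (nct_partial j) (vf_partial k)) (vf_partial l) = koszul j k l)"
proof
  let ?P = "\<lambda>j k l. g (D (nct_partial j) (vf_partial k)) (vf_partial l)"
  \<comment> \<open>Exchanging the slots costs an adjoint, which self-adjointness removes.\<close>
  have swap: "g (vf_partial k) (D (nct_partial j) (vf_partial l)) = ?P j l k" for j k l
    using D_self_adjoint [of j l k] by (simp add: star_g)
  {
    assume lc: "levi_civita \<Theta> g D"
    have P: "nct_partial j (g (vf_partial k) (vf_partial l)) = ?P j k l + ?P j l k" for j k l
      using lc nct_partial_star_derivation [of j \<Theta>]
      unfolding levi_civita_def metric_compatible_def by (metis swap)
    have sym: "?P j k l = ?P k j l" for j k l
      using lc by (simp add: levi_civita_def torsion_free_def)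
    show "\<forall>j k l. ?P j k l = koszul j k l"
    \<comment> \<open>After inserting \<open>P\<close> for the three derivatives, torsion-freeness
      cancels everything except two copies of \<open>?P j k l\<close>.\<close>
    proof (intro allI smooth_torus_eqI)
      fix j k l m
      show "fcoeff (?P j k l) m = fcoeff (koszul j k l) m"
        unfolding koszul_def P fcoeff_cscale fcoeff_minus fcoeff_plus sym [of l j] sym [of l k] sym [of k j]
        by simp
    qed
  }
  assume K: "\<forall>j k l. ?P j k l = koszul j k l"
  have "D (nct_partial j) (vf_partial k) = D (nct_partial k) (vf_partial j)" for j k
    by (rule vf_eqI)
      (simp add: K koszul_def add.commute g_partial_sym [of j k])
  then have tf: "torsion_free D" by (simp add: torsion_free_def)
  have P: "nct_partial j (g (vf_partial k) (vf_partial l)) = koszul j k l + koszul j l k" for j k l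
    by (rule smooth_torus_eqI)
      (simp only: koszul_def fcoeff_cscale fcoeff_minus fcoeff_plus g_partial_sym [of l k], simp add: field_simps)
  have basis: "nct_partial j (g X Y) = g (D (nct_partial j) X) Y + g X (D (nct_partial j) Y)" for j X Y
    by (rule compatible_if_on_basis [where E = "D (nct_partial j)"])
      (simp_all only: nct_partial_star_derivation D_add D_leibniz swap K P)
  have "\<delta> (g X Y) = g (D \<delta> X) Y + g X (D \<delta> Y)" if \<delta>: "\<delta> \<in> star_derivations \<Theta>" for \<delta> X Y
  proof -
    obtain c b where c: "\<And>j. cnj (c j) = c j" and b: "nct_star \<Theta> b = - b" "nct_trace b = 0"
      and eq: "\<delta> = outer_inner \<Theta> c b" using D_decompose [OF \<delta>] by metis
    \<comment> \<open>The real c_j leave the second slot unchanged, while b leaves it as its adjoint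
      - b on the right. Together with b on the left from the first slot this is the commutator with
      b.\<close>
    show ?thesis
      unfolding eq D_outer_inner [OF c b] g_add_left g_add_right g_sum_left g_sum_right
        g_cscale_left g_cscale_right g_mult_left g_mult_right c b outer_inner_def nct_ad_def basis
      by (simp add: cscale_add_right sum.distrib nct.minus_mult_right [symmetric] add_ac)
  qed
  then show "levi_civita \<Theta> g D"
    using tf connection by (simp add: levi_civita_def metric_compatible_def)
qed

end

section \<open>Construction of the connection\<close>

lemma outer_inner_scale: "outer_inner \<Theta> (\<lambda>j. z * c j) (z *\<^sub>c b) a = z *\<^sub>c outer_inner \<Theta> c b a"
  by (simp add: outer_inner_def nct_ad_def cscale_add_right cscale_diff_right cscale_sum_right cscale_cscale)

lemma outer_inner_plus:
  "outer_inner \<Theta> (\<lambda>j. c j + c' j) (b + b') a = outer_inner \<Theta> c b a + outer_inner \<Theta> c' b' a"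
  by (simp add: outer_inner_def nct_ad_def cscale_add_left nct_mult_add_left nct_mult_add_right
      sum.distrib algebra_simps)

lemma outer_inner_ad: "outer_inner \<Theta> (\<lambda>j. 0) b = nct_ad \<Theta> b"
  by (simp add: outer_inner_def [abs_def])

lemma outer_inner_partial: "outer_inner \<Theta> (\<lambda>i. if i = j then 1 else 0) 0 = nct_partial j"
proof
  fix a
  have "(\<Sum>i\<in>UNIV. (if i = j then 1 else 0) *\<^sub>c nct_partial i a) = (\<Sum>i\<in>UNIV. if i = j then nct_partial j a else 0)"
    by (intro sum.cong) auto
  then show "outer_inner \<Theta> (\<lambda>i. if i = j then 1 else 0) 0 a = nct_partial j a"
    by (simp add: outer_inner_def nct_ad_def)
qed

context nct_metric
begin

text \<open>The Koszul terms prescribe a left-linear functional on the basis, and nondegeneracy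
  represents it by a vector field.\<close>

lemma koszul_representable:
  assumes "nondegenerate_metric \<Theta> g"
  obtains G where "\<And>j k l. g (G j k) (vf_partial l) = koszul j k l"
proof -
  have "\<exists>Y. \<forall>l. g Y (vf_partial l) = koszul j k l" for j k
  proof -
    define \<phi> where "\<phi> X = (\<Sum>l\<in>UNIV. nct_mult \<Theta> (X $ l) (koszul j k l))" for X
    have "\<phi> (X + X') = \<phi> X + \<phi> X'" for X X'
      by (simp add: \<phi>_def nct_mult_add_left sum.distrib)
    moreover have "\<phi> (vf_mult \<Theta> a X) = nct_mult \<Theta> a (\<phi> X)" for a X
    proof -
      have "nct_mult \<Theta> a (sum f A) = (\<Sum>x\<in>A. nct_mult \<Theta> a (f x))" for f and A :: "'n set"
        by (induction A rule: infinite_finite_induct) (simp_all add: nct_mult_add_right)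
      then show ?thesis by (simp add: \<phi>_def nct_mult_assoc)
    qed
    ultimately obtain Y where Y: "\<And>X. \<phi> X = g X Y"
      using assms unfolding nondegenerate_metric_def by metis
    have "\<phi> (vf_partial l) = koszul j k l" for l
    proof -
      have "\<phi> (vf_partial l) = (\<Sum>i\<in>UNIV. if i = l then koszul j k i else 0)"
        unfolding \<phi>_def by (intro sum.cong) (auto simp: vf_partial_component nct_mult_one_left)
      then show ?thesis by simp
    qed
    \<comment> \<open>The representing field sits in the second slot; the adjoint moves it to the
      first, and \<open>koszul\<close> is self-adjoint.\<close>
    then have "g Y (vf_partial l) = koszul j k l" for l
      by (metis Y star_g star_koszul)
    then show ?thesis by blast
  qed
  then show thesis using that by metis
qed

lemma ex_connection:
  assumes skew: "transpose \<Theta> = - \<Theta>" and generic: "generically_transcendental \<Theta>"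
    and G: "\<And>j k l. g (G j k) (vf_partial l) = koszul j k l"
  obtains D where "connection \<Theta> g D" "\<And>j k. D (nct_partial j) (vf_partial k) = G j k"
proof -
  let ?S = "star_derivations \<Theta>"
  have "\<forall>\<delta>\<in>?S. \<exists>c b. nct_trace b = 0 \<and> \<delta> = outer_inner \<Theta> c b"
    using nct_derivation_decomposition [OF skew generic] star_derivations_iff by metis
  then obtain cf bf where
    cbf: "\<And>\<delta>. \<delta> \<in> ?S \<Longrightarrow> nct_trace (bf \<delta>) = 0 \<and> \<delta> = outer_inner \<Theta> (cf \<delta>) (bf \<delta>)"
    by metis
  have uniq: "cf \<delta> = c \<and> bf \<delta> = b" if "\<delta> \<in> ?S" "nct_trace b = 0" "\<delta> = outer_inner \<Theta> c b" for \<delta> c b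
    using outer_inner_unique [OF skew generic] cbf that by metis
  \<comment> \<open>The value forced by the axioms. The summand Y_k b completes the inner
    derivation: \<open>nct_ad\<close> of b at Y_k plus Y_k b equals b Y_k, which is left
    multiplication by b.\<close>
  define T where "T c b \<delta> Y = (\<Sum>k\<in>UNIV. vf_mult \<Theta> (\<delta> (Y $ k) + nct_mult \<Theta> (Y $ k) b) (vf_partial k)
      + vf_mult \<Theta> (Y $ k) (\<Sum>j\<in>UNIV. vf_cscale (c j) (G j k)))" for c b \<delta> and Y :: "'n vfield"
  define D where "D = restrict (\<lambda>\<delta>. T (cf \<delta>) (bf \<delta>) \<delta>) ?S"
  \<comment> \<open>By uniqueness any trace-free normal form may be used to evaluate
    \<open>D\<close>; linearity then only needs normal forms of sums and multiples.\<close>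
  have D: "D \<delta> = T c b \<delta>" if "\<delta> \<in> ?S" "nct_trace b = 0" "\<delta> = outer_inner \<Theta> c b" for \<delta> c b
    using uniq [OF that] that(1) by (simp add: D_def)
  have scale: "D (\<lambda>a. z *\<^sub>c \<delta> a) Y = vf_cscale z (D \<delta> Y)"
    if \<delta>: "\<delta> \<in> ?S" and z: "(\<lambda>a. z *\<^sub>c \<delta> a) \<in> ?S" for z \<delta> Y
  proof -
    note cb = cbf [OF \<delta>]
    have "D (\<lambda>a. z *\<^sub>c \<delta> a) = T (\<lambda>j. z * cf \<delta> j) (z *\<^sub>c bf \<delta>) (\<lambda>a. z *\<^sub>c \<delta> a)"
    proof (rule D [OF z])
      show "(\<lambda>a. z *\<^sub>c \<delta> a) = outer_inner \<Theta> (\<lambda>j. z * cf \<delta> j) (z *\<^sub>c bf \<delta>)"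
        unfolding outer_inner_scale [abs_def] using cb by metis
    qed (use cb in \<open>simp add: nct_trace_def\<close>)
    moreover have "D \<delta> = T (cf \<delta>) (bf \<delta>) \<delta>" using D \<delta> cb by blast
    ultimately show ?thesis
      by (simp add: T_def vf_cscale_sum_right vf_cscale_add_right vf_mult_cscale_left
          vf_mult_cscale_right vf_mult_sum_right cscale_add_right [symmetric] vf_cscale_cscale)
  qed
  have plus: "D (\<lambda>a. \<delta> a + \<delta>' a) Y = D \<delta> Y + D \<delta>' Y" if \<delta>: "\<delta> \<in> ?S" "\<delta>' \<in> ?S" for \<delta> \<delta>' Y
  proof -
    note cb = cbf [OF \<delta>(1)] and cb' = cbf [OF \<delta>(2)]
    have "D (\<lambda>a. \<delta> a + \<delta>' a) = T (\<lambda>j. cf \<delta> j + cf \<delta>' j) (bf \<delta> + bf \<delta>') (\<lambda>a. \<delta> a + \<delta>' a)"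
    proof (rule D [OF star_derivations_plus [OF \<delta>]])
      show "(\<lambda>a. \<delta> a + \<delta>' a) = outer_inner \<Theta> (\<lambda>j. cf \<delta> j + cf \<delta>' j) (bf \<delta> + bf \<delta>')"
        unfolding outer_inner_plus [abs_def] using cb cb' by metis
    qed (use cb cb' in \<open>simp add: nct_trace_def\<close>)
    moreover have "D \<delta> = T (cf \<delta>) (bf \<delta>) \<delta>" "D \<delta>' = T (cf \<delta>') (bf \<delta>') \<delta>'" using D \<delta> cb cb' by blast+
    ultimately show ?thesis
      by (simp add: T_def sum.distrib vf_mult_add_left vf_mult_add_right vf_cscale_add_left
          nct_mult_add_right add_ac)
  qed
  have linear: "D \<delta> (Y + Y') = D \<delta> Y + D \<delta> Y' \<and> D \<delta> (vf_cscale z Y) = vf_cscale z (D \<delta> Y)"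
    and leibniz: "D \<delta> (vf_mult \<Theta> a Y) = vf_mult \<Theta> (\<delta> a) Y + vf_mult \<Theta> a (D \<delta> Y)"
    if \<delta>: "\<delta> \<in> ?S" for \<delta> Y Y' z a
  proof -
    have d: "\<delta> \<in> nct_derivations \<Theta>" using \<delta> by (simp add: star_derivations_iff)
    obtain c b where T: "D \<delta> = T c b \<delta>" using D [OF \<delta>] cbf [OF \<delta>] by blast
    have "T c b \<delta> (Y + Y') = T c b \<delta> Y + T c b \<delta> Y'"
      by (simp add: T_def nct_derivations_add [OF d] sum.distrib vf_mult_add_left
          nct_mult_add_left add_ac)
    moreover have "T c b \<delta> (vf_cscale z Y) = vf_cscale z (T c b \<delta> Y)"
      by (simp add: T_def nct_derivations_cscale [OF d] vf_cscale_sum_right vf_cscale_add_right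
          vf_mult_cscale_left cscale_add_right [symmetric])
    ultimately show "D \<delta> (Y + Y') = D \<delta> Y + D \<delta> Y' \<and> D \<delta> (vf_cscale z Y) = vf_cscale z (D \<delta> Y)"
      by (simp add: T)
    \<comment> \<open>Expansion in the basis brings this term into the shape of the sums in
      \<open>T\<close>.\<close>
    have "vf_mult \<Theta> (\<delta> a) Y = (\<Sum>k\<in>UNIV. vf_mult \<Theta> (nct_mult \<Theta> (\<delta> a) (Y $ k)) (vf_partial k))"
      using arg_cong [OF vf_expand [of \<Theta> Y], of "vf_mult \<Theta> (\<delta> a)"]
      by (simp add: vf_mult_sum_right vf_mult_vf_mult)
    then show "D \<delta> (vf_mult \<Theta> a Y) = vf_mult \<Theta> (\<delta> a) Y + vf_mult \<Theta> a (D \<delta> Y)"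
      unfolding T by (simp add: T_def nct_derivations_mult [OF d] sum.distrib vf_mult_add_left
          vf_mult_add_right nct_mult_add_right vf_mult_sum_right vf_mult_vf_mult nct_mult_assoc add_ac)
  qed
  have ad: "D (nct_ad \<Theta> a) Y = vf_mult \<Theta> a Y" if "nct_trace a = 0" "nct_ad \<Theta> a \<in> ?S" for a Y
  proof -
    have "D (nct_ad \<Theta> a) = T (\<lambda>j. 0) a (nct_ad \<Theta> a)"
      using D that outer_inner_ad by metis
    moreover have "nct_ad \<Theta> a b + nct_mult \<Theta> b a = nct_mult \<Theta> a b" for b
      by (simp add: nct_ad_def)
    ultimately have "D (nct_ad \<Theta> a) Y = (\<Sum>k\<in>UNIV. vf_mult \<Theta> a (vf_mult \<Theta> (Y $ k) (vf_partial k)))"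
      by (simp add: T_def vf_mult_vf_mult)
    then show ?thesis by (simp only: vf_mult_sum_right [symmetric] vf_expand)
  qed
  have partial: "D (nct_partial j) (vf_partial k) = G j k" for j k
  proof -
    have "D (nct_partial j) = T (\<lambda>i. if i = j then 1 else 0) 0 (nct_partial j)"
      by (rule D [OF nct_partial_star_derivation]) (simp_all add: nct_trace_def outer_inner_partial)
    moreover have "nct_partial j (vf_partial k $ i) = 0" for i
      by (rule smooth_torus_eqI) (simp add: vf_partial_component fcoeff_monom)
    moreover have "(\<Sum>i\<in>UNIV. vf_cscale (if i = j then 1 else 0) (G i l)) = G j l" for l
    proof -
      have "(\<Sum>i\<in>UNIV. vf_cscale (if i = j then 1 else 0) (G i l)) = (\<Sum>i\<in>UNIV. if i = j then G i l else 0)"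
        by (intro sum.cong) auto
      then show ?thesis by simp
    qed
    ultimately have "D (nct_partial j) (vf_partial k) = (\<Sum>l\<in>UNIV. vf_mult \<Theta> (vf_partial k $ l) (G j l))"
      by (simp add: T_def)
    also have "\<dots> = (\<Sum>l\<in>UNIV. if l = k then G j l else 0)"
      by (intro sum.cong) (auto simp: vf_partial_component)
    finally have "D (nct_partial j) (vf_partial k) = (\<Sum>l\<in>UNIV. if l = k then G j l else 0)" .
    then show ?thesis by simp
  qed
  have "connection \<Theta> g D"
    unfolding connection_def
    using scale plus linear leibniz ad
    by (simp add: partial G star_koszul) (simp add: D_def)
  then show thesis using that partial by blast
qed

end

section \<open>Existence, uniqueness and the Koszul formula\<close>

text \<open>Existence solves the Koszul equations by invertibility of the Gram matrix; uniqueness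
  follows from definiteness, which allows at most one solution.\<close>

theorem theorem2p1:
  fixes \<Theta> :: "'n::{finite,linorder} theta"
    and g :: "'n vfield \<Rightarrow> 'n vfield \<Rightarrow> 'n smooth_torus"
  assumes skew: "transpose \<Theta> = - \<Theta>"
    and generic: "generically_transcendental \<Theta>"
    and metric: "riemannian_metric \<Theta> g"
  shows "(nondegenerate_metric \<Theta> g \<longrightarrow> (\<exists>!D. levi_civita \<Theta> g D)) \<and>
    (\<forall>D D'. levi_civita \<Theta> g D \<and> levi_civita \<Theta> g D' \<longrightarrow> D = D') \<and>
    (\<forall>D. connection \<Theta> g D \<longrightarrow>
      (levi_civita \<Theta> g D \<longleftrightarrow>
        (\<forall>j k l. g (D (nct_partial j) (vf_partial k)) (vf_partial l) =
          (1 / 2) *\<^sub>c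
            (nct_partial j (g (vf_partial k) (vf_partial l)) +
             nct_partial k (g (vf_partial j) (vf_partial l)) -
             nct_partial l (g (vf_partial j) (vf_partial k))))))"
proof -
  interpret nct_metric \<Theta> g by unfold_locales (rule metric)
  have con: "nct_connection \<Theta> g D" if "connection \<Theta> g D" for D
    by unfold_locales (rule skew generic that)+
  have formula: "levi_civita \<Theta> g D \<longleftrightarrow>
      (\<forall>j k l. g (D (nct_partial j) (vf_partial k)) (vf_partial l) = koszul j k l)"
    if "connection \<Theta> g D" for D
    by (rule nct_connection.levi_civita_iff_koszul [OF con [OF that]])
  have unique: "D = D'" if D: "levi_civita \<Theta> g D" and D': "levi_civita \<Theta> g D'" for D D'
  proof -
    have c: "connection \<Theta> g D" "connection \<Theta> g D'" using D D' by (auto simp: levi_civita_def)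
    interpret D: nct_connection \<Theta> g D by (rule con [OF c(1)])
    interpret D': nct_connection \<Theta> g D' by (rule con [OF c(2)])
    have basis: "D (nct_partial j) (vf_partial k) = D' (nct_partial j) (vf_partial k)" for j k
      by (rule vf_eqI) (use formula [OF c(1)] formula [OF c(2)] D D' in simp)
    \<comment> \<open>Additivity and the Leibniz rule spread the agreement from coordinate fields to
      all fields.\<close>
    have partial: "D (nct_partial j) Y = D' (nct_partial j) Y" for j Y
    proof -
      let ?Y = "\<Sum>k\<in>UNIV. vf_mult \<Theta> (Y $ k) (vf_partial k)"
      have "D (nct_partial j) ?Y = D' (nct_partial j) ?Y"
        by (simp add: D.D_sum D'.D_sum D.D_leibniz D'.D_leibniz nct_partial_star_derivation basis)
      then show ?thesis by (simp only: vf_expand)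
    qed
    have "D \<delta> = D' \<delta>" if \<delta>: "\<delta> \<in> star_derivations \<Theta>" for \<delta>
    proof
      fix Y
      obtain c b where "\<And>j. cnj (c j) = c j" "nct_star \<Theta> b = - b" "nct_trace b = 0"
        and "\<delta> = outer_inner \<Theta> c b" using D.D_decompose [OF \<delta>] by metis
      then show "D \<delta> Y = D' \<delta> Y"
        by (simp add: D.D_outer_inner D'.D_outer_inner partial)
    qed
    \<comment> \<open>Outside the *-derivations both maps take the default value of extensional
      functions.\<close>
    then show ?thesis
      by (rule extensionalityI [OF D.D_extensional D'.D_extensional])
  qed
  moreover have "\<exists>D. levi_civita \<Theta> g D" if nondeg: "nondegenerate_metric \<Theta> g"
  proof -
    obtain G where G: "\<And>j k l. g (G j k) (vf_partial l) = koszul j k l"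
      using koszul_representable [OF nondeg] by metis
    obtain D where "connection \<Theta> g D" "\<And>j k. D (nct_partial j) (vf_partial k) = G j k"
      using ex_connection [OF skew generic G] by metis
    then show ?thesis using formula [of D] G by auto
  qed
  ultimately show ?thesis
    using formula unfolding koszul_def by blast
qed

end
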